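(* Let $\mathbb G$ be the Engel group and let $E\subseteq\mathbb G$ be a measurable set that has constant horizontal normal. Then there exists a Lipschitz Euclidean domain $\tilde E\subset\mathbb G$ that is equivalent to $E$, i.e. such that $\mathrm{vol}_{\mathbb G}(E\,\Delta\,\tilde E)=0$.
   Context: The Engel algebra is the 4-dimensional real Lie algebra with basis $X_1,X_2,X_3,X_4$ and brackets $[X_1,X_2]=X_3$, $[X_1,X_3]=X_4$, all other brackets of basis elements (up to antisymmetry) being $0$. The Engel group $\mathbb G$ is the connected simply connected Lie group with this Lie algebra; elements of $\mathrm{Lie}(\mathbb G)$ are regarded as left-invariant vector fields. The horizontal layer is $V_1=\mathbb R X_1\oplus\mathbb R X_2$. $\mathrm{vol}_{\mathbb G}$ is a fixed Haar measure (bi-invariant). For measurable $E\subset\mathbb G$ and $X\in \mathrm{Lie}(\mathbb G)$, write $X\mathbb 1_E\ge 0$ if $-\int_E X\phi\,d\mathrm{vol}_{\mathbb G}\ge 0$ for all $\phi\in C_c^\infty(\mathbb G)$ with $\phi\ge0$, and $X\mathbb 1_E=0$ if $\int_E X\phi\,d\mathrm{vol}_{\mathbb G}=0$ for all such $\phi$. Fix a scalar product $\langle\cdot|\cdot\rangle$ on $V_1$. $E$ has constant horizontal normal $X$ if $X\in V_1$, $X\mathbb 1_E\ge0$, and $Y\mathbb 1_E=0$ for every $Y\in V_1$ with $\langle X|Y\rangle=0$. A set $E\subseteq\mathbb G$ is a Lipschitz Euclidean domain if, for one (and thus for all) diffeomorphisms $f:\mathbb G\to\mathbb R^4$, the set $f(E)$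 is open and any point of the boundary of $f(E)$ has a neighborhood in which $f(E)$ can be described (after a choice of linear coordinates) as the upper-graph of a Lipschitz map of three variables. *)

theory Defs
  imports "HOL-Analysis.Analysis"
begin

section \<open>The Engel group\<close>

text \<open>
  The Engel algebra is \<open>\<real>\<^sup>4\<close> with basis \<open>X\<^sub>i = axis i 1\<close>. It is nilpotent of step 3, so the
  connected simply connected Lie group with this Lie algebra is \<open>\<real>\<^sup>4\<close> itself with the
  Baker-Campbell-Hausdorff product (exponential coordinates of the first kind): the unit is \<open>0\<close>,
  the inverse of \<open>x\<close> is \<open>-x\<close>, and the exponential map is the identity.
\<close>

type_synonym engel = "real^4"

definition engel_bracket :: "engel \<Rightarrow> engel \<Rightarrow> engel" where
  "engel_bracket x y = vector [0, 0, x$1 * y$2 - x$2 * y$1, x$1 * y$3 - x$3 * y$1]"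

definition engel_mult :: "engel \<Rightarrow> engel \<Rightarrow> engel" (infixl \<open>\<odot>\<close> 70) where
  "x \<odot> y = x + y + (1/2) *\<^sub>R engel_bracket x y
     + (1/12) *\<^sub>R engel_bracket x (engel_bracket x y)
     + (1/12) *\<^sub>R engel_bracket y (engel_bracket y x)"

definition horizontal :: "engel set" where
  "horizontal = span {axis 1 1, axis 2 1}"

text \<open>The left-invariant vector field with value \<open>X\<close> at the unit, and its action on functions.\<close>

definition left_inv_field :: "engel \<Rightarrow> engel \<Rightarrow> engel" where
  "left_inv_field X p = frechet_derivative (\<lambda>q. p \<odot> q) (at 0) X"

definition lie_deriv :: "engel \<Rightarrow> (engel \<Rightarrow> real) \<Rightarrow> engel \<Rightarrow> real" where
  "lie_deriv X \<phi> p = frechet_derivative \<phi> (at p) (left_inv_field X p)"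

text \<open>
  Lebesgue measure in exponential coordinates is a bi-invariant Haar measure, as proved below.
  Haar measures being unique up to a positive factor, any other choice gives the same notions below.
\<close>

abbreviation vol_engel :: "engel measure" where
  "vol_engel \<equiv> lebesgue"


section \<open>Smooth functions\<close>

text \<open>\<open>C_k k f\<close>: \<open>f\<close> is of class \<open>C\<^sup>k\<close> on the whole space.\<close>

fun C_k :: "nat \<Rightarrow> ('a::real_normed_vector \<Rightarrow> 'b::real_normed_vector) \<Rightarrow> bool" where
  "C_k 0 f \<longleftrightarrow> continuous_on UNIV f"
| "C_k (Suc k) f \<longleftrightarrow> (\<forall>x. f differentiable (at x)) \<and>
     (\<forall>v. C_k k (\<lambda>x. frechet_derivative f (at x) v))"

definition smooth :: "('a::real_normed_vector \<Rightarrow> 'b::real_normed_vector) \<Rightarrow> bool" where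
  "smooth f \<longleftrightarrow> (\<forall>k. C_k k f)"

definition diffeomorphism :: "('a::real_normed_vector \<Rightarrow> 'b::real_normed_vector) \<Rightarrow> bool" where
  "diffeomorphism f \<longleftrightarrow> bij f \<and> smooth f \<and> smooth (inv f)"

definition nonneg_test_function :: "(engel \<Rightarrow> real) \<Rightarrow> bool" where
  "nonneg_test_function \<phi> \<longleftrightarrow>
     smooth \<phi> \<and> compact (closure {p. \<phi> p \<noteq> 0}) \<and> (\<forall>p. \<phi> p \<ge> 0)"


section \<open>Sets with constant horizontal normal\<close>

definition indicator_deriv_nonneg :: "engel \<Rightarrow> engel set \<Rightarrow> bool" where
  "indicator_deriv_nonneg X E \<longleftrightarrow>
     (\<forall>\<phi>. nonneg_test_function \<phi> \<longrightarrow> - (LINT p:E|vol_engel. lie_deriv X \<phi> p) \<ge> 0)"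

definition indicator_deriv_zero :: "engel \<Rightarrow> engel set \<Rightarrow> bool" where
  "indicator_deriv_zero X E \<longleftrightarrow>
     (\<forall>\<phi>. nonneg_test_function \<phi> \<longrightarrow> (LINT p:E|vol_engel. lie_deriv X \<phi> p) = 0)"

text \<open>Only the values of \<open>B\<close> on \<open>V \<times> V\<close> matter.\<close>

definition scalar_product_on :: "'a::real_vector set \<Rightarrow> ('a \<Rightarrow> 'a \<Rightarrow> real) \<Rightarrow> bool" where
  "scalar_product_on V B \<longleftrightarrow>
     (\<forall>x\<in>V. \<forall>y\<in>V. B x y = B y x) \<and>
     (\<forall>x\<in>V. \<forall>y\<in>V. \<forall>z\<in>V. B (x + y) z = B x z + B y z) \<and>
     (\<forall>c. \<forall>x\<in>V. \<forall>y\<in>V. B (c *\<^sub>R x) y = c * B x y) \<and>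
     (\<forall>x\<in>V. x \<noteq> 0 \<longrightarrow> B x x > 0)"

definition constant_horizontal_normal ::
  "(engel \<Rightarrow> engel \<Rightarrow> real) \<Rightarrow> engel set \<Rightarrow> engel \<Rightarrow> bool" where
  "constant_horizontal_normal B E X \<longleftrightarrow>
     X \<in> horizontal \<and> indicator_deriv_nonneg X E \<and>
     (\<forall>Y\<in>horizontal. B X Y = 0 \<longrightarrow> indicator_deriv_zero Y E)"


section \<open>Lipschitz Euclidean domains\<close>

text \<open>
  The linear coordinates are a linear isomorphism \<open>A\<close> onto \<open>\<real>\<^sup>3 \<times> \<real>\<close>. The upper-graph is strict
  because \<open>\<Omega>\<close> is open. Letting \<open>g\<close> be Lipschitz on all of \<open>\<real>\<^sup>3\<close> is no restriction, since
  real-valued Lipschitz functions extend from arbitrary subsets.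
\<close>

definition locally_lipschitz_upper_graph :: "(real^4) set \<Rightarrow> bool" where
  "locally_lipschitz_upper_graph \<Omega> \<longleftrightarrow>
     (\<forall>x\<in>frontier \<Omega>. \<exists>U (A :: real^4 \<Rightarrow> (real^3) \<times> real) (g :: real^3 \<Rightarrow> real) L.
        open U \<and> x \<in> U \<and> linear A \<and> bij A \<and> L-lipschitz_on UNIV g \<and>
        \<Omega> \<inter> U = {y \<in> U. snd (A y) > g (fst (A y))})"

definition lipschitz_euclidean_domain :: "engel set \<Rightarrow> bool" where
  "lipschitz_euclidean_domain E \<longleftrightarrow>
     (\<exists>f :: engel \<Rightarrow> real^4. diffeomorphism f \<and> open (f ` E) \<and>
        locally_lipschitz_upper_graph (f ` E))"


section \<open>Consistency of the model\<close>

lemma vector_4_nth [simp]: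
  "(vector [a, b, c, d] :: 'a::zero^4) $ 1 = a"
  "(vector [a, b, c, d] :: 'a::zero^4) $ 2 = b"
  "(vector [a, b, c, d] :: 'a::zero^4) $ 3 = c"
  "(vector [a, b, c, d] :: 'a::zero^4) $ 4 = d"
  unfolding vector_def by simp_all

lemma engel_bracket_nth [simp]:
  "engel_bracket x y $ 1 = 0"
  "engel_bracket x y $ 2 = 0"
  "engel_bracket x y $ 3 = x$1 * y$2 - x$2 * y$1"
  "engel_bracket x y $ 4 = x$1 * y$3 - x$3 * y$1"
  by (simp_all add: engel_bracket_def)

lemma engel_bracket_basis:
  fixes X :: "4 \<Rightarrow> engel"
  defines "X \<equiv> \<lambda>i. axis i 1"
  shows "engel_bracket (X 1) (X 2) = X 3" "engel_bracket (X 1) (X 3) = X 4"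
    "engel_bracket (X 1) (X 4) = 0" "engel_bracket (X 2) (X 3) = 0"
    "engel_bracket (X 2) (X 4) = 0" "engel_bracket (X 3) (X 4) = 0"
  by (auto simp: X_def vec_eq_iff forall_4 axis_def)

lemma bilinear_engel_bracket: "bilinear engel_bracket"
  by (auto simp: bilinear_def vec_eq_iff forall_4 algebra_simps intro!: linearI)

lemma engel_bracket_skew: "engel_bracket y x = - engel_bracket x y"
  by (simp add: vec_eq_iff forall_4)

lemma engel_bracket_jacobi:
  "engel_bracket x (engel_bracket y z) + engel_bracket y (engel_bracket z x)
     + engel_bracket z (engel_bracket x y) = 0"
  by (simp add: vec_eq_iff forall_4 algebra_simps)

lemma engel_mult_assoc: "(x \<odot> y) \<odot> z = x \<odot> (y \<odot> z)"
  by (simp add: vec_eq_iff forall_4 engel_mult_def) (simp add: field_simps)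

lemma engel_mult_unit: "0 \<odot> x = x" "x \<odot> 0 = x"
  by (simp_all add: vec_eq_iff forall_4 engel_mult_def)

lemma engel_mult_inverse: "(- x) \<odot> x = 0" "x \<odot> (- x) = 0"
  by (simp_all add: vec_eq_iff forall_4 engel_mult_def)

lemma engel_one_parameter_subgroup: "(s *\<^sub>R X) \<odot> (t *\<^sub>R X) = (s + t) *\<^sub>R X"
  by (simp add: vec_eq_iff forall_4 engel_mult_def algebra_simps)

lemma bounded_bilinear_engel_bracket: "bounded_bilinear engel_bracket"
  using bilinear_engel_bracket bilinear_conv_bounded_bilinear by blast

lemmas engel_bracket_has_derivative [derivative_intros] =
  bounded_bilinear.FDERIV [OF bounded_bilinear_engel_bracket]

lemma engel_mult_left_has_derivative:
  "((\<lambda>q. p \<odot> q) has_derivative (\<lambda>v. v + (1/2) *\<^sub>R engel_bracket p v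
      + (1/12) *\<^sub>R engel_bracket p (engel_bracket p v)
      + (1/12) *\<^sub>R (engel_bracket q (engel_bracket v p) + engel_bracket v (engel_bracket q p)))) (at q)"
  unfolding engel_mult_def
  by (auto intro!: derivative_eq_intros simp: vec_eq_iff forall_4 algebra_simps)

lemma engel_mult_right_has_derivative:
  "((\<lambda>q. q \<odot> p) has_derivative (\<lambda>v. v + (1/2) *\<^sub>R engel_bracket v p
      + (1/12) *\<^sub>R (engel_bracket q (engel_bracket v p) + engel_bracket v (engel_bracket q p))
      + (1/12) *\<^sub>R engel_bracket p (engel_bracket p v))) (at q)"
  unfolding engel_mult_def
  by (auto intro!: derivative_eq_intros simp: vec_eq_iff forall_4 algebra_simps)

lemma left_inv_field_eq:
  "left_inv_field X p =
     X + (1/2) *\<^sub>R engel_bracket p X + (1/12) *\<^sub>R engel_bracket p (engel_bracket p X)"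
  unfolding left_inv_field_def
    frechet_derivative_at [OF engel_mult_left_has_derivative, symmetric]
  by (simp add: vec_eq_iff forall_4)

lemma left_inv_field_left_invariant:
  "frechet_derivative (\<lambda>q. p \<odot> q) (at q) (left_inv_field X q) = left_inv_field X (p \<odot> q)"
  unfolding left_inv_field_eq
    frechet_derivative_at [OF engel_mult_left_has_derivative, symmetric]
  by (simp add: vec_eq_iff forall_4 engel_mult_def) (simp add: field_simps)

text \<open>
  The commutator of left-invariant vector fields, in coordinates \<open>DW(V) - DV(W)\<close>, is given by the
  bracket of the Engel algebra.
\<close>

lemma left_inv_field_has_derivative:
  "(left_inv_field X has_derivative (\<lambda>v. (1/2) *\<^sub>R engel_bracket v X
      + (1/12) *\<^sub>R (engel_bracket p (engel_bracket v X) + engel_bracket v (engel_bracket p X)))) (at p)"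
  unfolding left_inv_field_eq [abs_def]
  by (auto intro!: derivative_eq_intros simp: vec_eq_iff forall_4 algebra_simps)

lemma left_inv_field_commutator:
  "frechet_derivative (left_inv_field Y) (at p) (left_inv_field X p)
     - frechet_derivative (left_inv_field X) (at p) (left_inv_field Y p)
   = left_inv_field (engel_bracket X Y) p"
  unfolding frechet_derivative_at [OF left_inv_field_has_derivative, symmetric]
  unfolding left_inv_field_eq
  by (simp add: vec_eq_iff forall_4) (simp add: field_simps)

lemma det_4:
  "det (A::'a::comm_ring_1^4^4) =
     A$1$1 * (A$2$2 * A$3$3 * A$4$4 + A$2$3 * A$3$4 * A$4$2 + A$2$4 * A$3$2 * A$4$3
       - A$2$2 * A$3$4 * A$4$3 - A$2$3 * A$3$2 * A$4$4 - A$2$4 * A$3$3 * A$4$2)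
   - A$1$2 * (A$2$1 * A$3$3 * A$4$4 + A$2$3 * A$3$4 * A$4$1 + A$2$4 * A$3$1 * A$4$3
       - A$2$1 * A$3$4 * A$4$3 - A$2$3 * A$3$1 * A$4$4 - A$2$4 * A$3$3 * A$4$1)
   + A$1$3 * (A$2$1 * A$3$2 * A$4$4 + A$2$2 * A$3$4 * A$4$1 + A$2$4 * A$3$1 * A$4$2
       - A$2$1 * A$3$4 * A$4$2 - A$2$2 * A$3$1 * A$4$4 - A$2$4 * A$3$2 * A$4$1)
   - A$1$4 * (A$2$1 * A$3$2 * A$4$3 + A$2$2 * A$3$3 * A$4$1 + A$2$3 * A$3$1 * A$4$2
       - A$2$1 * A$3$3 * A$4$2 - A$2$2 * A$3$1 * A$4$3 - A$2$3 * A$3$2 * A$4$1)"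
proof -
  have f1234: "finite {2::4, 3, 4}" "1 \<notin> {2::4, 3, 4}" by auto
  have f234: "finite {3::4, 4}" "2 \<notin> {3::4, 4}" by auto
  have f34: "finite {4::4}" "3 \<notin> {4::4}" by auto
  show ?thesis
    unfolding det_def UNIV_4
    unfolding sum_over_permutations_insert[OF f1234]
    unfolding sum_over_permutations_insert[OF f234]
    unfolding sum_over_permutations_insert[OF f34]
    unfolding permutes_sing
    by (simp add: sign_swap_id permutation_swap_id permutation_compose sign_compose sign_id
        swap_id_eq)
      (simp only: ring_distribs mult.assoc diff_conv_add_uminus minus_add_distrib minus_minus
        mult_minus_left mult_minus_right, simp only: ac_simps)
qed

lemma emeasure_lebesgue_image_det_1:
  fixes h :: "engel \<Rightarrow> engel"
  assumes S: "S \<in> sets lebesgue" and inj: "inj h"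
    and der: "\<And>x. (h has_derivative h' x) (at x)"
    and det: "\<And>x. det (matrix (h' x)) = 1"
  shows "h ` S \<in> sets lebesgue" "emeasure lebesgue (h ` S) = emeasure lebesgue S"
proof -
  have der': "\<And>x. x \<in> S \<Longrightarrow> (h has_derivative h' x) (at x within S)"
    using der has_derivative_at_withinI by blast
  have inj': "inj_on h S" using inj by (rule inj_on_subset) simp
  show img: "h ` S \<in> sets lebesgue"
    using S der' by (intro differentiable_image_in_sets_lebesgue)
      (auto simp: differentiable_on_def differentiable_def)
  have "h ` S \<in> lmeasurable \<and> measure lebesgue (h ` S) = m
      \<longleftrightarrow> ((\<lambda>x. 1) has_integral m) S" for m
    using has_measure_differentiable_image [OF S der' inj', of m] by (simp add: det)
  then have iff: "h ` S \<in> lmeasurable \<and> measure lebesgue (h ` S) = m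
      \<longleftrightarrow> S \<in> lmeasurable \<and> measure lebesgue S = m" for m
    by (metis has_integral_iff lmeasurable_iff_integrable_on lmeasure_integral)
  show "emeasure lebesgue (h ` S) = emeasure lebesgue S"
  proof (cases "S \<in> lmeasurable")
    case True
    then show ?thesis using iff [of "measure lebesgue S"] by (simp add: emeasure_eq_measure2)
  next
    case False
    then have "h ` S \<notin> lmeasurable" using iff by blast
    with False S img show ?thesis by (metis fmeasurableI infinity_ennreal_def less_top)
  qed
qed

lemma vol_engel_left_invariant:
  assumes "S \<in> sets vol_engel"
  shows "(\<lambda>q. p \<odot> q) ` S \<in> sets vol_engel"
    "emeasure vol_engel ((\<lambda>q. p \<odot> q) ` S) = emeasure vol_engel S"
proof -
  have inj: "inj (\<lambda>q. p \<odot> q)"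
    by (metis engel_mult_assoc engel_mult_inverse(1) engel_mult_unit(1) injI)
  let ?J = "\<lambda>q v. v + (1/2) *\<^sub>R engel_bracket p v
      + (1/12) *\<^sub>R engel_bracket p (engel_bracket p v)
      + (1/12) *\<^sub>R (engel_bracket q (engel_bracket v p) + engel_bracket v (engel_bracket q p))"
  have "det (matrix (?J q)) = 1" for q
    unfolding det_4 matrix_def vec_lambda_beta
    by (simp add: axis_def)
  note * = emeasure_lebesgue_image_det_1 [OF assms inj engel_mult_left_has_derivative this]
  show "(\<lambda>q. p \<odot> q) ` S \<in> sets vol_engel"
    by (rule *(1))
  show "emeasure vol_engel ((\<lambda>q. p \<odot> q) ` S) = emeasure vol_engel S"
    by (rule *(2))
qed

lemma vol_engel_right_invariant:
  assumes "S \<in> sets vol_engel"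
  shows "(\<lambda>q. q \<odot> p) ` S \<in> sets vol_engel"
    "emeasure vol_engel ((\<lambda>q. q \<odot> p) ` S) = emeasure vol_engel S"
proof -
  have inj: "inj (\<lambda>q. q \<odot> p)"
    by (metis engel_mult_assoc engel_mult_inverse(2) engel_mult_unit(2) injI)
  let ?J = "\<lambda>q v. v + (1/2) *\<^sub>R engel_bracket v p
      + (1/12) *\<^sub>R (engel_bracket q (engel_bracket v p) + engel_bracket v (engel_bracket q p))
      + (1/12) *\<^sub>R engel_bracket p (engel_bracket p v)"
  have "det (matrix (?J q)) = 1" for q
    unfolding det_4 matrix_def vec_lambda_beta
    by (simp add: axis_def)
  note * = emeasure_lebesgue_image_det_1 [OF assms inj engel_mult_right_has_derivative this]
  show "(\<lambda>q. q \<odot> p) ` S \<in> sets vol_engel"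
    by (rule *(1))
  show "emeasure vol_engel ((\<lambda>q. q \<odot> p) ` S) = emeasure vol_engel S"
    by (rule *(2))
qed

end

theory Submission
  imports Defs
begin

text \<open>
  Integrating a distributional inequality \<open>X 1\<^sub>E \<ge> 0\<close> along the flow of \<open>X\<close> shows that, for
  \<open>t \<ge> 0\<close>, right translation by \<open>exp(tX)\<close> maps almost all of \<open>E\<close> into \<open>E\<close>. The elements \<open>g\<close> with
  this property form a semigroup. It contains \<open>exp(tX)\<close> for \<open>t \<ge> 0\<close>, where \<open>X\<close> is the normal, and
  \<open>exp(tY)\<close> for all \<open>t\<close>, where \<open>Y\<close> spans the orthogonal complement of \<open>X\<close> in the horizontal layer.
  Writing group elements as \<open>n exp(uY')\<close> with \<open>n\<close> in the abelian normal subgroup generated by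
  \<open>X\<^sub>2, X\<^sub>3, X\<^sub>4\<close> and \<open>Y'\<close> a horizontal complement, the semigroup contains an open convex cone \<open>K\<close> of
  these coordinates, and left translates of \<open>K\<close> are Euclidean translates of \<open>K\<close>. By Fubini, the
  union of the translates of \<open>K\<close> at almost all points of \<open>E\<close> is contained in \<open>E\<close> up to a null set, and its
  closure contains almost all of \<open>E\<close>. Since it is an open set monotone along \<open>K\<close>, its boundary is
  a Lipschitz graph, hence a null set.
\<close>

section \<open>Calculus of smooth functions\<close>

declare C_k.simps(2) [simp del]

lemma C_k_SucI:
  assumes "\<And>x. (f has_derivative f' x) (at x)" "\<And>v. C_k k (\<lambda>x. f' x v)"
  shows "C_k (Suc k) f"
proof -
  have "frechet_derivative f (at x) = f' x" for x
    using assms(1) frechet_derivative_at by metis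
  then show ?thesis
    using assms by (auto simp: differentiable_def C_k.simps)
qed

lemma C_k_Suc_has_derivative:
  "C_k (Suc k) f \<Longrightarrow> (f has_derivative frechet_derivative f (at x)) (at x)"
  using frechet_derivative_works by (auto simp: C_k.simps)

lemma C_k_SucD: "C_k (Suc k) f \<Longrightarrow> C_k k (\<lambda>x. frechet_derivative f (at x) v)"
  by (simp add: C_k.simps)

lemma C_k_Suc_imp: "C_k (Suc k) f \<Longrightarrow> C_k k f"
proof (induction k arbitrary: f)
  case 0
  then show ?case
    by (auto intro!: continuous_at_imp_continuous_on differentiable_imp_continuous_within simp: C_k.simps)
next
  case (Suc k)
  then show ?case by (metis C_k.simps(2))
qed

lemma C_k_imp_continuous: "C_k k f \<Longrightarrow> continuous_on S f"
proof (induction k)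
  case 0
  then show ?case using continuous_on_subset by auto
qed (use C_k_Suc_imp in blast)

lemma C_k_const: "C_k k (\<lambda>x. c)"
proof (induction k arbitrary: c)
  case (Suc k)
  show ?case by (rule C_k_SucI[where f'="\<lambda>_ _. 0"]) (auto simp: Suc)
qed simp

lemma C_k_bounded_linear:
  assumes "bounded_linear f"
  shows "C_k k f"
proof (cases k)
  case 0
  with assms show ?thesis by (simp add: linear_continuous_on)
next
  case (Suc n)
  have "C_k (Suc n) f"
    by (rule C_k_SucI[where f'="\<lambda>_. f"])
      (use assms in \<open>auto intro: C_k_const bounded_linear_imp_has_derivative\<close>)
  with Suc show ?thesis by simp
qed

lemma C_k_add: "C_k k f \<Longrightarrow> C_k k g \<Longrightarrow> C_k k (\<lambda>x. f x + g x)"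
proof (induction k arbitrary: f g)
  case (Suc k)
  show ?case
    using Suc.prems
    by (intro C_k_SucI[OF has_derivative_add] Suc.IH) (auto intro: C_k_Suc_has_derivative C_k_SucD)
qed (auto intro: continuous_intros)

lemma (in bounded_linear) C_k_compose: "C_k k g \<Longrightarrow> C_k k (\<lambda>x. f (g x))"
proof (induction k arbitrary: g)
  case 0
  then show ?case by (simp add: continuous_on)
next
  case (Suc k)
  show ?case
    using Suc.prems
    by (intro C_k_SucI[OF has_derivative] Suc.IH) (auto intro: C_k_Suc_has_derivative C_k_SucD)
qed

lemma (in bounded_bilinear) C_k_prod:
  "C_k k f \<Longrightarrow> C_k k g \<Longrightarrow> C_k k (\<lambda>x. prod (f x) (g x))"
proof (induction k arbitrary: f g)
  case 0
  then show ?case by (simp add: continuous_on)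
next
  case (Suc k)
  have "C_k k (\<lambda>x. prod (f x) (frechet_derivative g (at x) v) + prod (frechet_derivative f (at x) v) (g x))" for v
    by (rule C_k_add; rule Suc.IH; rule C_k_SucD C_k_Suc_imp; fact Suc.prems)
  then show ?case
    by (rule C_k_SucI[OF FDERIV[OF C_k_Suc_has_derivative C_k_Suc_has_derivative, OF Suc.prems]])
qed

lemmas C_k_mult = bounded_bilinear.C_k_prod [OF bounded_bilinear_mult]
lemmas C_k_scaleR = bounded_bilinear.C_k_prod [OF bounded_bilinear_scaleR]
lemmas C_k_inner = bounded_bilinear.C_k_prod [OF bounded_bilinear_inner]

lemma C_k_minus: "C_k k f \<Longrightarrow> C_k k (\<lambda>x. - f x)"
  by (rule bounded_linear.C_k_compose [OF bounded_linear_minus[OF bounded_linear_ident]])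

lemma C_k_diff: "C_k k f \<Longrightarrow> C_k k g \<Longrightarrow> C_k k (\<lambda>x. f x - g x)"
  using C_k_add[OF _ C_k_minus] by force

lemma C_k_sum: "(\<And>i. i \<in> I \<Longrightarrow> C_k k (f i)) \<Longrightarrow> C_k k (\<lambda>x. \<Sum>i\<in>I. f i x)"
  by (induction I rule: infinite_finite_induct) (auto intro: C_k_const C_k_add)

lemma C_k_vec:
  fixes f :: "'a::real_normed_vector \<Rightarrow> real^'n"
  assumes "\<And>i. C_k k (\<lambda>x. f x $ i)"
  shows "C_k k f"
proof -
  let ?f = "\<lambda>x. \<Sum>i\<in>UNIV. f x $ i *\<^sub>R (axis i 1 :: real^'n)"
  have "C_k k (\<lambda>x. f x $ i *\<^sub>R axis i 1 :: real^'n)" for i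
    by (rule C_k_scaleR[OF assms C_k_const])
  then have "C_k k ?f"
    by (rule C_k_sum)
  moreover have "?f = f"
    by (simp only: scalar_mult_eq_scaleR[symmetric] basis_expansion)
  then have "C_k k ?f = C_k k f"
    by (rule arg_cong)
  ultimately show ?thesis by (rule iffD1[rotated])
qed

lemma C_k_nth: "C_k k (\<lambda>x. x $ i)" for i :: "'n::finite" and k
  by (rule C_k_bounded_linear) (rule bounded_linear_vec_nth)

text \<open>\<open>C_k\<close> controls derivatives in fixed directions, but in the chain rule the
  direction varies with the point. Expanding it in \<open>Basis\<close> turns the derivative into a
  sum of products of functions of class \<open>C_k k\<close>.\<close>

lemma C_k_compose:
  fixes g :: "'a::real_normed_vector \<Rightarrow> 'b::euclidean_space"
  shows "C_k k f \<Longrightarrow> C_k k g \<Longrightarrow> C_k k (\<lambda>x. f (g x))"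
proof (induction k arbitrary: f g)
  case 0
  then show ?case
    using continuous_on_compose2[of UNIV f UNIV g] by simp
next
  case (Suc k)
  let ?Df = "\<lambda>y. frechet_derivative f (at y)" and ?Dg = "\<lambda>x. frechet_derivative g (at x)"
  have "((\<lambda>x. f (g x)) has_derivative (\<lambda>v. ?Df (g x) (?Dg x v))) (at x)" for x
    using has_derivative_compose[OF C_k_Suc_has_derivative[OF Suc.prems(2)]
        C_k_Suc_has_derivative[OF Suc.prems(1)]] .
  moreover have "?Df (g x) (?Dg x v) = (\<Sum>b\<in>Basis. (?Dg x v \<bullet> b) *\<^sub>R ?Df (g x) b)" for x v
  proof -
    have lin: "linear (?Df (g x))"
      using C_k_Suc_has_derivative[OF Suc.prems(1)] has_derivative_linear by blast
    have "(\<Sum>b\<in>Basis. (?Dg x v \<bullet> b) *\<^sub>R ?Df (g x) b)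
        = ?Df (g x) (\<Sum>b\<in>Basis. (?Dg x v \<bullet> b) *\<^sub>R b)"
      by (simp only: linear_sum[OF lin] linear_cmul[OF lin])
    then show ?thesis by (simp only: euclidean_representation)
  qed
  ultimately have D: "((\<lambda>x. f (g x)) has_derivative
      (\<lambda>v. \<Sum>b\<in>Basis. (?Dg x v \<bullet> b) *\<^sub>R ?Df (g x) b)) (at x)" for x
    by (simp only:)
  have 1: "C_k k (\<lambda>x. ?Df (g x) b)" for b
    by (rule Suc.IH[OF C_k_SucD[OF Suc.prems(1)] C_k_Suc_imp[OF Suc.prems(2)]])
  have 2: "C_k k (\<lambda>x. ?Dg x v \<bullet> b)" for v b
    by (rule C_k_inner[OF C_k_SucD[OF Suc.prems(2)] C_k_const])
  have "C_k k (\<lambda>x. \<Sum>b\<in>Basis. (?Dg x v \<bullet> b) *\<^sub>R ?Df (g x) b)" for v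
    by (rule C_k_sum) (rule C_k_scaleR[OF 2 1])
  then show ?case
    by (rule C_k_SucI[where f'="\<lambda>x v. \<Sum>b\<in>Basis. (?Dg x v \<bullet> b) *\<^sub>R ?Df (g x) b", OF D])
qed

text \<open>Membership in a family closed under differentiation replaces a formula for the higher
  derivatives.\<close>

lemma C_k_derivative_sequence:
  fixes s :: "nat \<Rightarrow> real \<Rightarrow> real"
  assumes "\<And>n t. (s n has_real_derivative s (Suc n) t) (at t)"
  shows "C_k k (s n)"
proof (induction k arbitrary: n)
  case 0
  show ?case
    using DERIV_isCont[OF assms] by (simp add: continuous_at_imp_continuous_on)
next
  case (Suc k)
  show ?case
    by (rule C_k_SucI[where f'="\<lambda>t v. s (Suc n) t * v"])
      (use assms C_k_mult[OF Suc C_k_const] in \<open>auto simp: has_field_derivative_def\<close>)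
qed

section \<open>Smooth bump functions\<close>

lemma C_k_exp: "C_k k (exp :: real \<Rightarrow> real)"
  by (rule C_k_derivative_sequence[where s="\<lambda>_. exp"]) (rule DERIV_exp)

text \<open>For \<open>q = 1\<close> this is the classical function that is flat at the origin. The
  polynomial factor makes the family closed under differentiation.\<close>

definition flat_poly :: "real poly \<Rightarrow> real \<Rightarrow> real" where
  "flat_poly q t = (if t > 0 then poly q (1/t) * exp (- (1/t)) else 0)"

lemma poly_times_exp_tendsto_0: "((\<lambda>x::real. poly q x * exp (- x)) \<longlongrightarrow> 0) at_top"
proof -
  have "((\<lambda>x. \<Sum>i\<le>degree q. coeff q i * (x ^ i / exp x)) \<longlongrightarrow> (\<Sum>i\<le>degree q. coeff q i * 0)) at_top"
    by (intro tendsto_intros tendsto_power_div_exp_0)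
  moreover have "(\<lambda>x. \<Sum>i\<le>degree q. coeff q i * (x ^ i / exp x)) = (\<lambda>x. poly q x * exp (- x))"
    by (simp add: poly_altdef sum_distrib_right exp_minus divide_inverse mult.assoc)
  ultimately show ?thesis by simp
qed

text \<open>For \<open>t > 0\<close> the derivative of \<open>q(1/t) exp(-1/t)\<close> is
  \<open>(1/t)^2 (q - q')(1/t) exp(-1/t)\<close>, and \<open>[:0, 0, 1:]\<close> is the polynomial
  \<open>x^2\<close>. At the origin the right difference quotient is \<open>x q(x) exp(-x)\<close>
  with \<open>x = 1/h\<close>, which decays at infinity.\<close>

lemma flat_poly_has_derivative:
  "(flat_poly q has_real_derivative flat_poly ([:0, 0, 1:] * (q - pderiv q)) t) (at t)"
proof -
  consider "t > 0" | "t < 0" | "t = 0" by linarith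
  then show ?thesis
  proof cases
    case 1
    have "((\<lambda>t. poly q (1/t) * exp (- (1/t))) has_real_derivative
        flat_poly ([:0, 0, 1:] * (q - pderiv q)) t) (at t)"
      using 1 by (auto intro!: derivative_eq_intros poly_DERIV[THEN DERIV_chain2]
          simp: flat_poly_def field_simps power2_eq_square)
    then show ?thesis
      by (rule has_field_derivative_transform_within_open[where S="{0<..}"])
        (use 1 in \<open>auto simp: flat_poly_def\<close>)
  next
    case 2
    have "((\<lambda>t. 0) has_real_derivative 0) (at t)" by simp
    then have "(flat_poly q has_real_derivative 0) (at t)"
      by (rule has_field_derivative_transform_within_open[where S="{..<0}"])
        (use 2 in \<open>auto simp: flat_poly_def\<close>)
    then show ?thesis using 2 by (simp add: flat_poly_def)
  next
    case 3
    have "((\<lambda>h. flat_poly q h / h) \<longlongrightarrow> 0) (at_left 0)"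
      by (rule tendsto_eventually) (auto simp: flat_poly_def eventually_at_filter)
    moreover have "((\<lambda>h. poly (pCons 0 q) (inverse h) * exp (- inverse h)) \<longlongrightarrow> 0) (at_right 0)"
      using poly_times_exp_tendsto_0[of "pCons 0 q"] by (simp only: filterlim_at_top_to_right)
    then have "((\<lambda>h. flat_poly q h / h) \<longlongrightarrow> 0) (at_right 0)"
      by (rule Lim_transform_eventually)
        (auto simp: flat_poly_def eventually_at_filter divide_inverse)
    ultimately have "((\<lambda>h. flat_poly q h / h) \<longlongrightarrow> 0) (at 0)"
      using filterlim_split_at by blast
    then show ?thesis
      using 3 by (simp add: DERIV_def flat_poly_def)
  qed
qed

lemma C_k_flat_poly: "C_k k (flat_poly q)"
  using C_k_derivative_sequence[where n=0 and k=k and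
      s="\<lambda>n. flat_poly (((\<lambda>q. [:0, 0, 1:] * (q - pderiv q)) ^^ n) q)"]
    flat_poly_has_derivative
  by simp

text \<open>The parameter \<open>r\<close> is a squared radius, so for \<open>r \<le> 0\<close> the
  function vanishes identically. The inner product, unlike the norm, is smooth at the center
  too.\<close>

definition bump :: "'a::real_inner \<Rightarrow> real \<Rightarrow> 'a \<Rightarrow> real" where
  "bump c r x = flat_poly 1 (r - (x - c) \<bullet> (x - c))"

lemma bump_pos_iff: "bump c r x > 0 \<longleftrightarrow> (x - c) \<bullet> (x - c) < r"
  and bump_nonneg: "bump c r x \<ge> 0"
  by (auto simp: bump_def flat_poly_def)

lemma C_k_bump: "C_k k (bump c r)"
  unfolding bump_def[abs_def]
  by (intro C_k_compose[OF C_k_flat_poly] C_k_diff C_k_inner C_k_const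
      C_k_bounded_linear[OF bounded_linear_ident])

section \<open>Test functions converging to the indicator of an open set\<close>

lemma countable_subfamily_same_Union:
  fixes D :: "'i \<Rightarrow> 'a::second_countable_topology set"
  assumes "\<And>i. i \<in> I \<Longrightarrow> open (D i)"
  obtains J where "J \<subseteq> I" "countable J" "(\<Union>i\<in>J. D i) = (\<Union>i\<in>I. D i)"
proof -
  have "open S" if "S \<in> D ` I" for S
    using that assms by auto
  then obtain F where F: "F \<subseteq> D ` I" "countable F" "\<Union>F = (\<Union>i\<in>I. D i)"
    by (rule Lindelof)
  then obtain J where "countable J" "J \<subseteq> I" "F = D ` J"
    using countable_subset_image[of F D I] by metis
  with F(3) show ?thesis
    by (intro that[of J]) simp_all
qed

text \<open>Countably many balls inside \<open>U\<close> cover \<open>U\<close>. With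
  \<open>\<psi> n\<close> the sum of the first \<open>n\<close> bumps,
  \<open>1 - exp (- (n * \<psi> n))\<close> stays in \<open>[0, 1)\<close> and vanishes off
  \<open>U\<close>. At a point of \<open>U\<close> one positive bump is eventually present in every
  sum, so the exponent tends to minus infinity.\<close>

lemma test_functions_tendsto_indicator:
  assumes "open U" "bounded U"
  obtains \<phi> where "\<And>n. nonneg_test_function (\<phi> n)" "\<And>n x. \<phi> n x \<le> indicat_real U x"
    "\<And>x. (\<lambda>n. \<phi> n x) \<longlonglongrightarrow> indicator U x"
proof -
  define D where "D z = {x. (x - fst z) \<bullet> (x - fst z) < snd z}" for z :: "engel \<times> real"
  define I where "I = {z. D z \<subseteq> U}"
  have opn: "open (D z)" for z
    unfolding D_def by (intro open_Collect_less continuous_intros)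
  obtain J where J: "J \<subseteq> I" "countable J" "(\<Union>z\<in>J. D z) = (\<Union>z\<in>I. D z)"
    using opn by (rule countable_subfamily_same_Union)
  have "\<exists>z\<in>I. x \<in> D z" if xU: "x \<in> U" for x
  proof -
    obtain e where e: "e > 0" "ball x e \<subseteq> U"
      using openE[OF \<open>open U\<close> xU] .
    have "D (x, e\<^sup>2) \<subseteq> ball x e"
    proof
      fix y assume "y \<in> D (x, e\<^sup>2)"
      then have "(norm (y - x))\<^sup>2 < e\<^sup>2"
        by (simp add: D_def power2_norm_eq_inner)
      then have "norm (y - x) < e"
        using \<open>e > 0\<close> by (simp add: power2_less_imp_less)
      then show "y \<in> ball x e"
        by (simp add: dist_norm norm_minus_commute)
    qed
    then have "(x, e\<^sup>2) \<in> I" "x \<in> D (x, e\<^sup>2)"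
      using e by (auto simp: I_def D_def)
    then show ?thesis by blast
  qed
  then have cover: "\<exists>z\<in>J. x \<in> D z" if "x \<in> U" for x
    using J(3) that by blast
  \<comment> \<open>The empty ball is adjoined so that the family can be enumerated even if
    \<open>J\<close> is empty.\<close>
  have "D (0, 0) = {}" by (auto simp: D_def not_less)
  then have I0: "(0, 0) \<in> I" by (auto simp: I_def)
  define z where "z = from_nat_into (insert (0, 0) J)"
  have ran: "range z = insert (0, 0) J"
    unfolding z_def by (rule range_from_nat_into) (use J in auto)
  have zI: "z i \<in> I" for i
    using ran I0 J(1) by (metis insert_subset rangeI subsetD)
  define \<psi> where "\<psi> n x = (\<Sum>i<n. bump (fst (z i)) (snd (z i)) x)" for n and x :: engel
  have C: "C_k k (\<psi> n)" for k n
    unfolding \<psi>_def[abs_def] by (intro C_k_sum C_k_bump)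
  have \<psi>_nonneg: "\<psi> n x \<ge> 0" for n x
    unfolding \<psi>_def by (intro sum_nonneg bump_nonneg)
  have \<psi>_0: "\<psi> n x = 0" if "x \<notin> U" for n x
  proof -
    have "\<not> bump (fst (z i)) (snd (z i)) x > 0" for i
      using zI[of i] that unfolding bump_pos_iff by (auto simp: I_def D_def)
    then show ?thesis
      unfolding \<psi>_def using bump_nonneg by (metis (no_types, lifting) less_le sum.neutral)
  qed
  define \<phi> where "\<phi> n x = 1 - exp (- (real n * \<psi> n x))" for n x
  show ?thesis
  proof
    show "nonneg_test_function (\<phi> n)" for n
    proof -
      have "C_k k (\<phi> n)" for k
        unfolding \<phi>_def[abs_def]
        by (intro C_k_diff C_k_const C_k_compose[OF C_k_exp] C_k_minus C_k_mult C)
      moreover have "{x. \<phi> n x \<noteq> 0} \<subseteq> U"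
        using \<psi>_0 by (auto simp: \<phi>_def)
      then have "compact (closure {x. \<phi> n x \<noteq> 0})"
        using \<open>bounded U\<close> by (meson bounded_subset compact_closure)
      moreover have "\<phi> n x \<ge> 0" for x
        using \<psi>_nonneg[of n x] by (simp add: \<phi>_def)
      ultimately show ?thesis
        by (auto simp: nonneg_test_function_def smooth_def)
    qed
    show "\<phi> n x \<le> indicat_real U x" for n x
      using \<psi>_0[of x n] by (auto simp: \<phi>_def indicator_def)
    show "(\<lambda>n. \<phi> n x) \<longlonglongrightarrow> indicator U x" for x
    proof (cases "x \<in> U")
      case True
      then obtain i where i: "x \<in> D (z i)"
        using cover ran by (metis insertCI rangeE)
      define d where "d = bump (fst (z i)) (snd (z i)) x"
      have "d > 0"
        using i by (auto simp: d_def bump_pos_iff D_def)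
      have le: "d \<le> \<psi> n x" if "i < n" for n
        unfolding d_def \<psi>_def using that by (intro member_le_sum bump_nonneg) auto
      have "\<forall>\<^sub>F n in sequentially. d * real n \<le> real n * \<psi> n x"
        by (rule eventually_mono[OF eventually_gt_at_top[of i]])
          (simp add: le mult.commute[of d] mult_left_mono)
      moreover have "filterlim (\<lambda>n. d * real n) at_top sequentially"
        using \<open>d > 0\<close> by (intro filterlim_tendsto_pos_mult_at_top[OF tendsto_const] filterlim_real_sequentially)
      ultimately have "filterlim (\<lambda>n. real n * \<psi> n x) at_top sequentially"
        by (rule filterlim_at_top_mono[rotated])
      then have "(\<lambda>n. exp (- (real n * \<psi> n x))) \<longlonglongrightarrow> 0"
        by (intro filterlim_compose[OF exp_at_bot]) (simp add: filterlim_uminus_at_bot)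
      then have "(\<lambda>n. 1 - exp (- (real n * \<psi> n x))) \<longlonglongrightarrow> 1 - 0"
        by (rule tendsto_diff[OF tendsto_const])
      then show ?thesis using True by (simp add: \<phi>_def)
    next
      case False
      then show ?thesis by (simp add: \<phi>_def \<psi>_0)
    qed
  qed
qed

section \<open>Translating test functions\<close>

lemma continuous_on_engel_mult:
  "continuous_on S f \<Longrightarrow> continuous_on S g \<Longrightarrow> continuous_on S (\<lambda>x. f x \<odot> g x)"
  unfolding engel_mult_def
  by (intro continuous_on_add continuous_on_scaleR continuous_on_const
      bounded_bilinear.continuous_on[OF bounded_bilinear_engel_bracket])

lemma C_k_engel_mult: "C_k k f \<Longrightarrow> C_k k g \<Longrightarrow> C_k k (\<lambda>x. f x \<odot> g x)"
  unfolding engel_mult_def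
  by (assumption | rule C_k_add | rule C_k_scaleR[OF C_k_const]
      | rule bounded_bilinear.C_k_prod[OF bounded_bilinear_engel_bracket])+

lemma engel_mult_cancel [simp]: "p \<odot> g \<odot> (- g) = p" "p \<odot> (- g) \<odot> g = p"
  "(- g) \<odot> (g \<odot> p) = p" "g \<odot> ((- g) \<odot> p) = p"
  by (simp_all add: engel_mult_assoc engel_mult_inverse engel_mult_unit)
     (simp_all add: engel_mult_assoc[symmetric] engel_mult_inverse engel_mult_unit)

lemma test_function_C_k: "nonneg_test_function \<phi> \<Longrightarrow> C_k k \<phi>"
  by (simp add: nonneg_test_function_def smooth_def)

lemma test_function_continuous: "nonneg_test_function \<phi> \<Longrightarrow> continuous_on S \<phi>"
  using test_function_C_k C_k_imp_continuous by metis

lemma test_function_translate: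
  assumes "nonneg_test_function \<phi>"
  shows "nonneg_test_function (\<lambda>p. \<phi> (p \<odot> g))"
proof -
  let ?K = "closure {p. \<phi> p \<noteq> 0}"
  have "compact ((\<lambda>p. p \<odot> (- g)) ` ?K)"
    using assms
    by (intro compact_continuous_image continuous_on_engel_mult continuous_on_const continuous_on_id)
      (simp add: nonneg_test_function_def)
  moreover have "p \<in> (\<lambda>p. p \<odot> (- g)) ` ?K" if "\<phi> (p \<odot> g) \<noteq> 0" for p
  proof
    show "p \<odot> g \<in> ?K" using that closure_subset[of "{p. \<phi> p \<noteq> 0}"] by auto
  qed simp
  then have "{p. \<phi> (p \<odot> g) \<noteq> 0} \<subseteq> (\<lambda>p. p \<odot> (- g)) ` ?K"
    by blast
  ultimately have "bounded {p. \<phi> (p \<odot> g) \<noteq> 0}"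
    using bounded_subset compact_imp_bounded by blast
  moreover have "C_k k (\<lambda>p. \<phi> (p \<odot> g))" for k
    by (intro C_k_compose[OF test_function_C_k[OF assms]] C_k_engel_mult C_k_const
        C_k_bounded_linear[OF bounded_linear_ident])
  ultimately show ?thesis
    using assms by (simp add: nonneg_test_function_def smooth_def)
qed

lemma integrable_lebesgue_compact_support:
  fixes f :: "'a::euclidean_space \<Rightarrow> real"
  assumes "continuous_on UNIV f" "compact K" "\<And>x. x \<notin> K \<Longrightarrow> f x = 0"
  shows "integrable lebesgue f"
proof -
  have "integrable lborel (\<lambda>x. indicator K x *\<^sub>R f x)"
    using assms continuous_on_subset[of UNIV f K] by (intro borel_integrable_compact) auto
  moreover have "(\<lambda>x. indicator K x *\<^sub>R f x) = f"
    using assms(3) by (auto simp: fun_eq_iff indicator_def)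
  ultimately show ?thesis
    using assms(1) by (simp add: integrable_completion borel_measurable_continuous_onI)
qed

lemma test_function_integrable:
  assumes "nonneg_test_function \<phi>"
  shows "integrable lebesgue \<phi>"
proof (rule integrable_lebesgue_compact_support)
  show "compact (closure {p. \<phi> p \<noteq> 0})"
    using assms by (simp add: nonneg_test_function_def)
  show "\<phi> x = 0" if "x \<notin> closure {p. \<phi> p \<noteq> 0}" for x
    using that closure_subset[of "{p. \<phi> p \<noteq> 0}"] by auto
qed (rule test_function_continuous[OF assms])

section \<open>Differentiation along the flow of a left-invariant field\<close>

lemma flow_has_derivative_at_0:
  assumes "\<phi> differentiable (at p)"
  shows "((\<lambda>t. \<phi> (p \<odot> (t *\<^sub>R X))) has_real_derivative lie_deriv X \<phi> p) (at 0)"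
proof -
  let ?L = "\<lambda>v. v + (1/2) *\<^sub>R engel_bracket p v + (1/12) *\<^sub>R engel_bracket p (engel_bracket p v)"
  have L: "((\<lambda>q. p \<odot> q) has_derivative ?L) (at (0 *\<^sub>R X))"
    by (rule has_derivative_eq_rhs[OF engel_mult_left_has_derivative])
      (simp add: fun_eq_iff vec_eq_iff forall_4)
  have "((\<lambda>t. t *\<^sub>R X) has_derivative (\<lambda>t. t *\<^sub>R X)) (at 0)"
    by (intro bounded_linear_imp_has_derivative bounded_linear_scaleR_left)
  from has_derivative_compose[OF this L]
  have "((\<lambda>t. p \<odot> (t *\<^sub>R X)) has_derivative (\<lambda>t. ?L (t *\<^sub>R X))) (at 0)" .
  moreover have "(\<phi> has_derivative frechet_derivative \<phi> (at p)) (at (p \<odot> (0 *\<^sub>R X)))"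
    using assms by (simp add: engel_mult_unit frechet_derivative_works)
  ultimately have "((\<lambda>t. \<phi> (p \<odot> (t *\<^sub>R X))) has_derivative
      (\<lambda>t. frechet_derivative \<phi> (at p) (?L (t *\<^sub>R X)))) (at 0)"
    by (rule has_derivative_compose)
  moreover have "?L (t *\<^sub>R X) = t *\<^sub>R left_inv_field X p" for t
    by (simp add: left_inv_field_eq vec_eq_iff forall_4 algebra_simps)
  moreover have "linear (frechet_derivative \<phi> (at p))"
    using assms frechet_derivative_works has_derivative_linear by blast
  ultimately show ?thesis
    by (simp add: has_field_derivative_def lie_deriv_def linear_cmul mult_commute_abs)
qed

text \<open>The one-parameter subgroup law moves the base point along the flow and reduces time
  \<open>s\<close> to time 0.\<close>

lemma flow_has_derivative:
  assumes "\<And>x. \<phi> differentiable (at x)"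
  shows "((\<lambda>t. \<phi> (p \<odot> (t *\<^sub>R X))) has_real_derivative lie_deriv X \<phi> (p \<odot> (s *\<^sub>R X))) (at s)"
proof -
  have "((\<lambda>t. \<phi> (p \<odot> ((t + s) *\<^sub>R X))) has_real_derivative lie_deriv X \<phi> (p \<odot> (s *\<^sub>R X))) (at 0)"
    using flow_has_derivative_at_0[OF assms, of "p \<odot> (s *\<^sub>R X)" X]
    by (simp add: engel_mult_assoc engel_one_parameter_subgroup add.commute)
  then show ?thesis
    using DERIV_shift[of "\<lambda>t. \<phi> (p \<odot> (t *\<^sub>R X))" _ 0 s] by simp
qed

text \<open>The direction \<open>left_inv_field X p\<close> varies with \<open>p\<close>, so it is
  again expanded in \<open>Basis\<close>.\<close>

lemma lie_deriv_continuous: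
  assumes "C_k 1 \<phi>"
  shows "continuous_on S (lie_deriv X \<phi>)"
proof -
  have C: "C_k (Suc 0) \<phi>" using assms by simp
  have lin: "linear (frechet_derivative \<phi> (at p))" for p
    using C_k_Suc_has_derivative[OF C] has_derivative_linear by blast
  have "lie_deriv X \<phi> p = frechet_derivative \<phi> (at p) (\<Sum>b\<in>Basis. (left_inv_field X p \<bullet> b) *\<^sub>R b)" for p
    by (simp only: lie_deriv_def euclidean_representation)
  then have eq: "lie_deriv X \<phi> = (\<lambda>p. \<Sum>b\<in>Basis. (left_inv_field X p \<bullet> b) *\<^sub>R frechet_derivative \<phi> (at p) b)"
    by (simp only: fun_eq_iff linear_sum[OF lin] linear_cmul[OF lin]) simp
  have "continuous_on S (\<lambda>p. frechet_derivative \<phi> (at p) b)" for b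
    by (rule C_k_imp_continuous[OF C_k_SucD[OF C]])
  moreover have "continuous_on S (left_inv_field X)"
    using left_inv_field_has_derivative
    by (intro continuous_at_imp_continuous_on ballI) (rule has_derivative_continuous)
  ultimately show ?thesis
    unfolding eq
    by (intro continuous_on_sum continuous_on_scaleR continuous_on_inner continuous_on_const)
qed

lemma lie_deriv_eq_0:
  assumes "p \<notin> closure {q. \<phi> q \<noteq> 0}"
  shows "lie_deriv X \<phi> p = 0"
proof -
  have "(\<phi> has_derivative (\<lambda>_. 0)) (at p)"
  proof (rule has_derivative_transform_within_open)
    show "((\<lambda>_. 0) has_derivative (\<lambda>_. 0)) (at p)" by simp
    show "open (- closure {q. \<phi> q \<noteq> 0})" "p \<in> - closure {q. \<phi> q \<noteq> 0}"
      using assms by auto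
    show "0 = \<phi> q" if "q \<in> - closure {q. \<phi> q \<noteq> 0}" for q
      using that closure_subset[of "{q. \<phi> q \<noteq> 0}"] by auto
  qed
  then show ?thesis
    by (metis frechet_derivative_at lie_deriv_def)
qed

lemma lie_deriv_bounded:
  assumes "nonneg_test_function \<phi>"
  obtains M where "M \<ge> 0" "\<And>p. \<bar>lie_deriv X \<phi> p\<bar> \<le> M"
proof -
  let ?K = "closure {p. \<phi> p \<noteq> 0}"
  have "compact (lie_deriv X \<phi> ` ?K)"
    using assms by (intro compact_continuous_image lie_deriv_continuous test_function_C_k)
      (simp_all add: nonneg_test_function_def)
  then obtain M where M: "M > 0" "\<forall>y\<in>lie_deriv X \<phi> ` ?K. norm y \<le> M"
    using bounded_pos[of "lie_deriv X \<phi> ` ?K"] compact_imp_bounded by metis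
  have "\<bar>lie_deriv X \<phi> p\<bar> \<le> M" for p
    using M lie_deriv_eq_0[of p \<phi> X] by (cases "p \<in> ?K") (simp_all add: less_imp_le)
  with M(1) show ?thesis
    using that[of M] by simp
qed

lemma lie_deriv_integrable:
  assumes "nonneg_test_function \<phi>"
  shows "integrable lebesgue (lie_deriv X \<phi>)"
  using assms
  by (intro integrable_lebesgue_compact_support[OF _ _ lie_deriv_eq_0[of _ \<phi>]]
      lie_deriv_continuous test_function_C_k) (simp_all add: nonneg_test_function_def)

text \<open>This is differentiation under the integral sign by dominated convergence: for
  \<open>\<bar>h\<bar> < 1\<close> the difference quotients are bounded by a bound on the Lie
  derivative and vanish off one compact set.\<close>

lemma flow_integral_has_derivative_at_0:
  assumes \<phi>: "nonneg_test_function \<phi>" and E: "E \<in> sets lebesgue"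
  shows "((\<lambda>t. LINT p:E|lebesgue. \<phi> (p \<odot> (t *\<^sub>R X))) has_real_derivative
    (LINT p:E|lebesgue. lie_deriv X \<phi> p)) (at 0)"
proof -
  let ?K0 = "closure {p. \<phi> p \<noteq> 0}"
  \<comment> \<open>\<open>K\<close> consists of the points reached from the support of
    \<open>\<phi>\<close> in time at most 1, forwards or backwards. Flowing back from
    \<open>p \<odot> (t *\<^sub>R X)\<close> shows that \<open>p\<close> lies in it.\<close>
  define K where "K = (\<lambda>(q, t). q \<odot> (t *\<^sub>R X)) ` (?K0 \<times> {-1..1})"
  have "compact ?K0"
    using \<phi> by (simp add: nonneg_test_function_def)
  then have "compact K"
    unfolding K_def split_def
    by (intro compact_continuous_image continuous_on_engel_mult continuous_on_fst continuous_on_snd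
        continuous_on_scaleR continuous_on_const continuous_on_id compact_Times compact_Icc)
  have inK: "p \<in> K" if "\<phi> (p \<odot> (t *\<^sub>R X)) \<noteq> 0" "\<bar>t\<bar> < 1" for p t
  proof -
    have "p = (\<lambda>(q, t). q \<odot> (t *\<^sub>R X)) (p \<odot> (t *\<^sub>R X), - t)"
      by simp
    moreover have "(p \<odot> (t *\<^sub>R X), - t) \<in> ?K0 \<times> {-1..1}"
      using that closure_subset[of "{p. \<phi> p \<noteq> 0}"] by auto
    ultimately show ?thesis
      unfolding K_def by (rule image_eqI)
  qed
  obtain M where M: "M \<ge> 0" "\<And>p. \<bar>lie_deriv X \<phi> p\<bar> \<le> M"
    using lie_deriv_bounded[OF \<phi>] by metis
  have diff: "\<phi> differentiable (at x)" for x
    using test_function_C_k[OF \<phi>, of "Suc 0"] by (simp add: C_k.simps)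
  have int: "integrable lebesgue (\<lambda>p. \<phi> (p \<odot> (t *\<^sub>R X)))" for t
    by (rule test_function_integrable[OF test_function_translate[OF \<phi>]])
  have lip: "\<bar>\<phi> (p \<odot> (t *\<^sub>R X)) - \<phi> p\<bar> \<le> M * \<bar>t\<bar>" for p t
    using field_differentiable_bound[OF convex_UNIV flow_has_derivative[OF diff, of p X], of M t 0] M(2)
    by (simp add: engel_mult_unit)
  define Q where "Q h p = (\<phi> (p \<odot> (h *\<^sub>R X)) - \<phi> p) / h" for h p
  have Q_bound: "\<bar>Q h p\<bar> \<le> M * indicator K p" if "h \<noteq> 0" "\<bar>h\<bar> < 1" for h p
  proof (cases "p \<in> K")
    case True
    then show ?thesis
      using lip[of p h] that by (simp add: Q_def divide_le_eq)
  next
    case False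
    then have "\<phi> (p \<odot> (h *\<^sub>R X)) = 0" "\<phi> (p \<odot> (0 *\<^sub>R X)) = 0"
      using inK[of p h] inK[of p 0] that by auto
    then show ?thesis
      using False by (simp add: Q_def engel_mult_unit)
  qed
  \<comment> \<open>The limit is taken within the open interval where the domination is valid; there
    the filter agrees with \<open>at 0\<close>.\<close>
  have lim: "((\<lambda>h. LINT p:E|lebesgue. Q h p) \<longlongrightarrow> (LINT p:E|lebesgue. lie_deriv X \<phi> p))
      (at 0 within {-1<..<1})"
    unfolding set_lebesgue_integral_def tendsto_at_iff_sequentially comp_def
  proof (intro allI impI)
    fix h :: "nat \<Rightarrow> real"
    assume h: "\<forall>i. h i \<in> {-1<..<1} - {0}" "h \<longlonglongrightarrow> 0"
    show "(\<lambda>i. \<integral>p. indicator E p *\<^sub>R Q (h i) p \<partial>lebesgue) \<longlonglongrightarrow>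
        (\<integral>p. indicator E p *\<^sub>R lie_deriv X \<phi> p \<partial>lebesgue)"
    proof (rule integral_dominated_convergence)
      show "(\<lambda>p. indicator E p *\<^sub>R lie_deriv X \<phi> p) \<in> borel_measurable lebesgue"
        using lie_deriv_integrable[OF \<phi>] E by measurable
      show "(\<lambda>p. indicator E p *\<^sub>R Q (h i) p) \<in> borel_measurable lebesgue" for i
        unfolding Q_def using int[of "h i"] test_function_integrable[OF \<phi>] E by measurable
      show "integrable lebesgue (\<lambda>p. M * indicator K p)"
        using lmeasurable_compact[OF \<open>compact K\<close>]
        by (intro integrable_mult_right integrable_real_indicator)
          (simp_all add: fmeasurable_def del: emeasure_completion)
      have "(\<lambda>i. Q (h i) p) \<longlonglongrightarrow> lie_deriv X \<phi> p" for p
      proof -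
        have "((\<lambda>h. Q h p) \<longlongrightarrow> lie_deriv X \<phi> p) (at 0)"
          using flow_has_derivative_at_0[OF diff, of p X]
          by (simp add: DERIV_def Q_def engel_mult_unit)
        then show ?thesis
          using h by (auto simp: tendsto_at_iff_sequentially comp_def)
      qed
      then show "AE p in lebesgue. (\<lambda>i. indicator E p *\<^sub>R Q (h i) p) \<longlonglongrightarrow> indicator E p *\<^sub>R lie_deriv X \<phi> p"
        by (intro AE_I2 tendsto_scaleR tendsto_const)
      show "AE p in lebesgue. norm (indicator E p *\<^sub>R Q (h i) p) \<le> M * indicator K p" for i
      proof (intro AE_I2)
        fix p
        have "h i \<noteq> 0" "\<bar>h i\<bar> < 1" using h(1) by (auto simp: abs_less_iff minus_less_iff)
        from Q_bound[OF this, of p] show "norm (indicator E p *\<^sub>R Q (h i) p) \<le> M * indicator K p"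
          using M(1) by (cases "p \<in> E") auto
      qed
    qed
  qed
  have Q_int: "(LINT p:E|lebesgue. Q h p)
      = ((LINT p:E|lebesgue. \<phi> (p \<odot> (h *\<^sub>R X))) - (LINT p:E|lebesgue. \<phi> p)) / h" for h
  proof -
    have "integrable lebesgue (\<lambda>p. indicator E p *\<^sub>R \<phi> (p \<odot> (h *\<^sub>R X)))"
      "integrable lebesgue (\<lambda>p. indicator E p *\<^sub>R \<phi> p)"
      using integrable_mult_indicator[OF E int[of h]]
        integrable_mult_indicator[OF E test_function_integrable[OF \<phi>]] by simp_all
    then show ?thesis
      unfolding Q_def set_lebesgue_integral_def
      by (simp add: diff_divide_distrib right_diff_distrib)
  qed
  have "at (0::real) within {-1<..<1} = at 0"
    by (rule at_within_open) auto
  with lim show ?thesis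
    unfolding DERIV_def Q_int by (simp only: add_0 scaleR_zero_left engel_mult_unit)
qed

text \<open>Flowing for time \<open>t + s\<close> amounts to flowing for time \<open>t\<close> and
  evaluating a translate of \<open>\<phi>\<close>, which is again a test function.\<close>

lemma flow_integral_has_derivative:
  assumes \<phi>: "nonneg_test_function \<phi>" and E: "E \<in> sets lebesgue"
  shows "((\<lambda>t. LINT p:E|lebesgue. \<phi> (p \<odot> (t *\<^sub>R X))) has_real_derivative
    (LINT p:E|lebesgue. lie_deriv X (\<lambda>q. \<phi> (q \<odot> (s *\<^sub>R X))) p)) (at s)"
  using flow_integral_has_derivative_at_0[OF test_function_translate[OF \<phi>, of "s *\<^sub>R X"] E, of X]
    DERIV_shift[of "\<lambda>t. LINT p:E|lebesgue. \<phi> (p \<odot> (t *\<^sub>R X))" _ 0 s]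
  by (simp add: engel_mult_assoc engel_one_parameter_subgroup)

text \<open>The hypothesis on \<open>X\<close>, applied to all translates of \<open>\<phi>\<close>
  along the flow, makes the time derivative of the integral nonpositive. The conclusion compares the
  times \<open>- t\<close> and 0.\<close>

lemma flow_integral_mono:
  assumes \<phi>: "nonneg_test_function \<phi>" and E: "E \<in> sets lebesgue"
    and X: "indicator_deriv_nonneg X E" and "t \<ge> 0"
  shows "(LINT p:E|lebesgue. \<phi> p) \<le> (LINT p:E|lebesgue. \<phi> (p \<odot> (- (t *\<^sub>R X))))"
proof -
  have "(LINT p:E|lebesgue. \<phi> (p \<odot> (0 *\<^sub>R X))) \<le> (LINT p:E|lebesgue. \<phi> (p \<odot> ((- t) *\<^sub>R X)))"
  proof (rule DERIV_nonpos_imp_nonincreasing[where f="\<lambda>t. LINT p:E|lebesgue. \<phi> (p \<odot> (t *\<^sub>R X))"])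
    fix s
    have "(LINT p:E|lebesgue. lie_deriv X (\<lambda>q. \<phi> (q \<odot> (s *\<^sub>R X))) p) \<le> 0"
      using X test_function_translate[OF \<phi>, of "s *\<^sub>R X"] by (auto simp: indicator_deriv_nonneg_def)
    with flow_integral_has_derivative[OF \<phi> E, of X s]
    show "\<exists>y. ((\<lambda>t. LINT p:E|lebesgue. \<phi> (p \<odot> (t *\<^sub>R X))) has_real_derivative y) (at s) \<and> y \<le> 0"
      by blast
  qed (use \<open>t \<ge> 0\<close> in simp)
  then show ?thesis by (simp add: engel_mult_unit)
qed

section \<open>Expanding elements\<close>

definition expanding :: "engel set \<Rightarrow> engel \<Rightarrow> bool" where
  "expanding E g \<longleftrightarrow> {p \<in> E. p \<odot> g \<notin> E} \<in> null_sets vol_engel"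

lemma right_translation_vimage: "{p. p \<odot> g \<in> S} = (\<lambda>p. p \<odot> (- g)) ` S"
proof safe
  fix p assume "p \<odot> g \<in> S"
  then have "p \<odot> g \<odot> (- g) \<in> (\<lambda>p. p \<odot> (- g)) ` S" by blast
  then show "p \<in> (\<lambda>p. p \<odot> (- g)) ` S" by simp
qed simp

lemma left_translation_vimage: "{q. p \<odot> q \<in> S} = (\<lambda>q. (- p) \<odot> q) ` S"
proof safe
  fix q assume "p \<odot> q \<in> S"
  then have "(- p) \<odot> (p \<odot> q) \<in> (\<lambda>q. (- p) \<odot> q) ` S" by blast
  then show "q \<in> (\<lambda>q. (- p) \<odot> q) ` S" by simp
qed simp

lemma right_translation_sets:
  "S \<in> sets vol_engel \<Longrightarrow> {p. p \<odot> g \<in> S} \<in> sets vol_engel"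
  "S \<in> sets vol_engel \<Longrightarrow> emeasure vol_engel {p. p \<odot> g \<in> S} = emeasure vol_engel S"
  by (simp_all only: right_translation_vimage vol_engel_right_invariant)

lemma right_translation_null_sets:
  "S \<in> null_sets vol_engel \<Longrightarrow> {p. p \<odot> g \<in> S} \<in> null_sets vol_engel"
  by (simp only: null_sets_def mem_Collect_eq right_translation_sets)

lemma left_translation_null_sets:
  "S \<in> null_sets vol_engel \<Longrightarrow> {q. p \<odot> q \<in> S} \<in> null_sets vol_engel"
  by (simp only: null_sets_def mem_Collect_eq left_translation_vimage vol_engel_left_invariant)

text \<open>A point that fails for \<open>g \<odot> h\<close> fails for \<open>g\<close>, or its
  translate by \<open>g\<close> fails for \<open>h\<close>. The second set of points is null by
  right invariance of the measure.\<close>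

lemma expanding_mult:
  assumes "expanding E g" "expanding E h"
  shows "expanding E (g \<odot> h)"
proof -
  have "{p \<in> E. p \<odot> g \<notin> E} \<union> {p. p \<odot> g \<in> {q \<in> E. q \<odot> h \<notin> E}} \<in> null_sets vol_engel"
    using assms by (intro null_sets.Un right_translation_null_sets) (simp_all add: expanding_def)
  moreover have "{p \<in> E. p \<odot> (g \<odot> h) \<notin> E} \<subseteq> {p \<in> E. p \<odot> g \<notin> E} \<union> {p. p \<odot> g \<in> {q \<in> E. q \<odot> h \<notin> E}}"
    by (auto simp: engel_mult_assoc)
  ultimately show ?thesis
    unfolding expanding_def by (rule null_sets_completion_subset[rotated])
qed

lemma set_integral_tendsto_measure:
  fixes f :: "nat \<Rightarrow> 'a::euclidean_space \<Rightarrow> real"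
  assumes "A \<in> sets lebesgue" "E \<in> sets lebesgue"
    and "\<And>n. f n \<in> borel_measurable lebesgue" "\<And>n x. 0 \<le> f n x" "\<And>n x. f n x \<le> indicator A x"
    and "\<And>x. (\<lambda>n. f n x) \<longlonglongrightarrow> indicator A x" and "emeasure lebesgue A < \<infinity>"
  shows "(\<lambda>n. LINT p:E|lebesgue. f n p) \<longlonglongrightarrow> measure lebesgue (E \<inter> A)"
proof -
  have "(\<lambda>n. \<integral>p. indicator E p *\<^sub>R f n p \<partial>lebesgue) \<longlonglongrightarrow> (\<integral>p. indicator E p *\<^sub>R indicat_real A p \<partial>lebesgue)"
  proof (rule integral_dominated_convergence)
    show "integrable lebesgue (indicat_real A)"
      using assms by (intro integrable_real_indicator)
    show "(\<lambda>p. indicator E p *\<^sub>R indicat_real A p) \<in> borel_measurable lebesgue"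
      using assms by measurable
    show "(\<lambda>p. indicator E p *\<^sub>R f n p) \<in> borel_measurable lebesgue" for n
      using assms(2,3) by measurable
    show "AE p in lebesgue. (\<lambda>n. indicator E p *\<^sub>R f n p) \<longlonglongrightarrow> indicator E p *\<^sub>R indicat_real A p"
      by (intro AE_I2 tendsto_scaleR tendsto_const assms)
    show "AE p in lebesgue. norm (indicator E p *\<^sub>R f n p) \<le> indicat_real A p" for n
    proof (intro AE_I2)
      fix p
      show "norm (indicator E p *\<^sub>R f n p) \<le> indicat_real A p"
        using assms(4,5)[of n p] by (cases "p \<in> E") auto
    qed
  qed
  moreover have "(\<integral>p. indicator E p *\<^sub>R indicat_real A p \<partial>lebesgue) = measure lebesgue (E \<inter> A)"
    using assms by (simp add: indicator_inter_arith[symmetric] del: measure_completion)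
  ultimately show ?thesis
    by (simp add: set_lebesgue_integral_def)
qed

text \<open>Test functions converging to the indicator of \<open>U\<close> turn the monotonicity of
  integrals into one of measures. The translated set \<open>V\<close> is then moved back to
  \<open>U\<close> by right invariance.\<close>

lemma expanding_open_measure_le:
  assumes E: "E \<in> sets vol_engel" and X: "indicator_deriv_nonneg X E" and t: "t \<ge> 0"
    and U: "open U" "bounded U"
  shows "measure vol_engel (E \<inter> U) \<le> measure vol_engel ({p. p \<odot> (t *\<^sub>R X) \<in> E} \<inter> U)"
proof -
  let ?g = "t *\<^sub>R X"
  obtain \<phi> where \<phi>: "\<And>n. nonneg_test_function (\<phi> n)" "\<And>n x. \<phi> n x \<le> indicat_real U x"
    "\<And>x. (\<lambda>n. \<phi> n x) \<longlonglongrightarrow> indicator U x"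
    using test_functions_tendsto_indicator[OF U] by blast
  define V where "V = {p. p \<odot> (- ?g) \<in> U}"
  have Um: "U \<in> sets lebesgue" "emeasure lebesgue U < \<infinity>"
    using lmeasurable_open[OF U(2,1)] by (simp_all add: fmeasurable_def del: emeasure_completion)
  then have Vm: "V \<in> sets lebesgue" "emeasure lebesgue V < \<infinity>"
    unfolding V_def by (simp_all only: right_translation_sets)
  have nonneg: "0 \<le> \<phi> n x" for n x
    using \<phi>(1) by (simp add: nonneg_test_function_def)
  have V_ind: "indicat_real V x = indicator U (x \<odot> (- ?g))" for x
    by (simp add: V_def indicator_def)
  have "(\<lambda>n. LINT p:E|lebesgue. \<phi> n p) \<longlonglongrightarrow> measure lebesgue (E \<inter> U)"
    using test_function_integrable[OF \<phi>(1)]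
    by (intro set_integral_tendsto_measure E Um nonneg \<phi>) auto
  moreover have "(\<lambda>n. LINT p:E|lebesgue. \<phi> n (p \<odot> (- ?g))) \<longlonglongrightarrow> measure lebesgue (E \<inter> V)"
    using test_function_integrable[OF test_function_translate[OF \<phi>(1)]]
    by (intro set_integral_tendsto_measure E Vm nonneg) (auto simp only: V_ind intro: \<phi>)
  moreover have "(LINT p:E|lebesgue. \<phi> n p) \<le> (LINT p:E|lebesgue. \<phi> n (p \<odot> (- ?g)))" for n
    by (rule flow_integral_mono[OF \<phi>(1) E X t])
  ultimately have "measure lebesgue (E \<inter> U) \<le> measure lebesgue (E \<inter> V)"
    by (intro LIMSEQ_le) blast+
  also have "emeasure lebesgue {p. p \<odot> ?g \<in> E \<inter> V} = emeasure lebesgue (E \<inter> V)"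
    using E Vm(1) by (intro right_translation_sets) blast
  then have "measure lebesgue (E \<inter> V) = measure lebesgue {p. p \<odot> ?g \<in> E \<inter> V}"
    by (simp only: measure_def)
  also have "{p. p \<odot> ?g \<in> E \<inter> V} = {p. p \<odot> ?g \<in> E} \<inter> U"
    by (auto simp: V_def)
  finally show ?thesis .
qed

text \<open>If a bounded part \<open>A\<close> of \<open>E - F\<close> had positive measure, outer
  regularity would give a bounded open \<open>U\<close> containing \<open>A\<close> such that
  \<open>U - A\<close> has measure less than that of \<open>A\<close>. Since \<open>F\<close> misses
  \<open>A\<close>, the measure of \<open>F \<inter> U\<close> would be less than that of
  \<open>E \<inter> U\<close>, against the inequality for open sets.\<close>

lemma expanding_flow:
  assumes E: "E \<in> sets vol_engel" and X: "indicator_deriv_nonneg X E" and t: "t \<ge> 0"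
  shows "expanding E (t *\<^sub>R X)"
proof -
  let ?g = "t *\<^sub>R X"
  define F where "F = {p. p \<odot> ?g \<in> E}"
  have F: "F \<in> sets lebesgue"
    unfolding F_def by (rule right_translation_sets[OF E])
  have "(E - F) \<inter> ball 0 (real n) \<in> null_sets lebesgue" for n
  proof (rule ccontr)
    define A where "A = (E - F) \<inter> ball 0 (real n)"
    assume "A \<notin> null_sets lebesgue"
    have A: "A \<in> lmeasurable"
      unfolding A_def using E F by (intro bounded_set_imp_lmeasurable) auto
    have "measure lebesgue A > 0"
      using A \<open>A \<notin> null_sets lebesgue\<close> measure_nonneg[of lebesgue A]
      by (metis less_le measure_eq_0_null_sets negligible_iff_measure negligible_iff_null_sets)
    then obtain T where T: "open T" "A \<subseteq> T" "T - A \<in> lmeasurable"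
      "emeasure lebesgue (T - A) < ennreal (measure lebesgue A)"
      using sets_lebesgue_outer_open A by (metis fmeasurableD)
    define U where "U = T \<inter> ball 0 (real n)"
    have U: "open U" "bounded U" "A \<subseteq> U" "U - A \<subseteq> T - A"
      using T by (auto simp: U_def A_def)
    have [measurable]: "U \<in> lmeasurable"
      using lmeasurable_open U by blast
    have "measure lebesgue A \<le> measure lebesgue (E \<inter> U)"
      using U(3) A E \<open>U \<in> lmeasurable\<close>
      by (intro measure_mono_fmeasurable) (auto simp: A_def fmeasurable_Int_fmeasurable Int_commute intro: fmeasurableI2)
    also have "\<dots> \<le> measure lebesgue (F \<inter> U)"
      unfolding F_def by (rule expanding_open_measure_le[OF E X t U(1,2)])
    also have "\<dots> \<le> measure lebesgue (T - A)"
      using F T U(4) \<open>U \<in> lmeasurable\<close>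
      by (intro measure_mono_fmeasurable) (auto simp: A_def)
    also have "\<dots> < measure lebesgue A"
      using T(3,4) \<open>measure lebesgue A > 0\<close>
      by (simp add: emeasure_eq_measure2 ennreal_less_iff del: emeasure_completion measure_completion)
    finally show False by simp
  qed
  then have "(\<Union>n. (E - F) \<inter> ball 0 (real n)) \<in> null_sets lebesgue"
    by (intro null_sets_UN)
  moreover have "(\<Union>n. (E - F) \<inter> ball 0 (real n)) = {p \<in> E. p \<odot> ?g \<notin> E}"
    using reals_Archimedean2 by (auto simp: F_def)
  ultimately show ?thesis
    by (simp add: expanding_def)
qed

lemma lie_deriv_linear_combination:
  assumes "nonneg_test_function \<phi>"
  shows "lie_deriv (a *\<^sub>R X + c *\<^sub>R Y) \<phi> p = a * lie_deriv X \<phi> p + c * lie_deriv Y \<phi> p"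
proof -
  have lin: "linear (frechet_derivative \<phi> (at p))"
    using C_k_Suc_has_derivative[OF test_function_C_k[OF assms]] has_derivative_linear by blast
  have "left_inv_field (a *\<^sub>R X + c *\<^sub>R Y) p = a *\<^sub>R left_inv_field X p + c *\<^sub>R left_inv_field Y p"
    by (simp add: left_inv_field_eq vec_eq_iff forall_4) (simp add: field_simps)
  then show ?thesis
    by (simp add: lie_deriv_def linear_add[OF lin] linear_cmul[OF lin])
qed

text \<open>Linearity in the field. The sign of \<open>c\<close> is free, so the normal may be
  changed by any multiple of an annihilating field.\<close>

lemma indicator_deriv_nonneg_combination:
  assumes E: "E \<in> sets vol_engel" and X: "indicator_deriv_nonneg X E" and Y: "indicator_deriv_zero Y E"
    and "a \<ge> 0"
  shows "indicator_deriv_nonneg (a *\<^sub>R X + c *\<^sub>R Y) E"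
  unfolding indicator_deriv_nonneg_def
proof (intro allI impI)
  fix \<phi> assume \<phi>: "nonneg_test_function \<phi>"
  have int: "set_integrable lebesgue E (lie_deriv Z \<phi>)" for Z
    unfolding set_integrable_def by (rule integrable_mult_indicator[OF E lie_deriv_integrable[OF \<phi>]])
  have "(LINT p:E|lebesgue. lie_deriv (a *\<^sub>R X + c *\<^sub>R Y) \<phi> p)
      = a * (LINT p:E|lebesgue. lie_deriv X \<phi> p) + c * (LINT p:E|lebesgue. lie_deriv Y \<phi> p)"
    unfolding lie_deriv_linear_combination[OF \<phi>]
    using int[of X] int[of Y]
    by (subst set_integral_add) (simp_all add: set_integrable_mult_right)
  then show "0 \<le> - (LINT p:E|lebesgue. lie_deriv (a *\<^sub>R X + c *\<^sub>R Y) \<phi> p)"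
    using X Y \<phi> \<open>a \<ge> 0\<close>
    by (simp add: indicator_deriv_nonneg_def indicator_deriv_zero_def mult_nonneg_nonpos)
qed

lemma expanding_subgroup:
  assumes E: "E \<in> sets vol_engel" and Y: "indicator_deriv_zero Y E"
  shows "expanding E (t *\<^sub>R Y)"
proof -
  have "indicator_deriv_nonneg Y E"
    using Y by (simp add: indicator_deriv_nonneg_def indicator_deriv_zero_def)
  then have "indicator_deriv_nonneg (0 *\<^sub>R Y + t *\<^sub>R Y) E"
    using E Y by (intro indicator_deriv_nonneg_combination) auto
  with E expanding_flow[of E "t *\<^sub>R Y" 1] show ?thesis by simp
qed

section \<open>From almost every point to almost every group element\<close>

lemma AE_completion_iff_null_sets:
  "(AE x in completion M. P x) \<longleftrightarrow> {x \<in> space M. \<not> P x} \<in> null_sets (completion M)"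
proof
  assume "AE x in completion M. P x"
  then obtain N where "N \<in> null_sets (completion M)" "{x \<in> space (completion M). \<not> P x} \<subseteq> N"
    unfolding eventually_ae_filter by auto
  then show "{x \<in> space M. \<not> P x} \<in> null_sets (completion M)"
    using null_sets_completion_subset by (metis space_completion)
qed (auto intro: AE_I')

text \<open>
  Fubini's theorem turns "almost every \<open>p \<in> E\<close>, for each \<open>g\<close>" into "each \<open>p\<close> in a conull part of
  \<open>E\<close>, for almost every \<open>g\<close>".
\<close>

lemma expanding_conull_points:
  assumes E: "E \<in> sets vol_engel" and S: "open S" "\<And>g. g \<in> S \<Longrightarrow> expanding E g"
  obtains P where "P \<subseteq> E" "E - P \<in> null_sets vol_engel"
    "\<And>p. p \<in> P \<Longrightarrow> (\<lambda>g. p \<odot> g) ` S - E \<in> null_sets vol_engel"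
proof -
  \<comment> \<open>Fubini is applied to the product of Borel measures, so \<open>E\<close> is
    replaced by a Borel set \<open>C\<close> that differs from it by a null set.\<close>
  obtain C T T' where C: "E = C \<union> T" "C \<in> sets borel" "T \<subseteq> T'" "T' \<in> null_sets lborel"
    using sets_completionE[OF E] by (metis sets_lborel)
  then have T: "T \<in> null_sets lebesgue"
    using null_sets_completionI null_sets_completion_subset by blast
  \<comment> \<open>The guards make the condition vacuous outside \<open>S\<close> and
    \<open>C\<close>, so it can be asserted almost everywhere in either variable.\<close>
  define Q where "Q p g \<longleftrightarrow> (g \<in> S \<longrightarrow> p \<in> C \<longrightarrow> p \<odot> g \<in> C)" for p g
  have "AE p in lborel. Q p g" for g
  proof (cases "g \<in> S")
    case True
    then have "{p \<in> E. p \<odot> g \<notin> E} \<union> {p. p \<odot> g \<in> T} \<in> null_sets lebesgue"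
      using S(2) T by (intro null_sets.Un right_translation_null_sets) (simp_all add: expanding_def)
    then have "AE p in lebesgue. Q p g"
      by (rule AE_I') (use C(1) in \<open>auto simp: Q_def\<close>)
    then show ?thesis by (simp only: AE_completion_iff)
  qed (simp add: Q_def)
  then have "AE g in lborel. AE p in lborel. Q p g"
    by simp
  moreover have "{z \<in> space (lborel \<Otimes>\<^sub>M lborel). Q (fst z) (snd z)} \<in> sets (lborel \<Otimes>\<^sub>M lborel)"
  proof -
    have "(\<lambda>z. fst z \<odot> snd z) \<in> borel_measurable (borel :: (engel \<times> engel) measure)"
      "fst \<in> borel_measurable (borel :: (engel \<times> engel) measure)"
      "snd \<in> borel_measurable (borel :: (engel \<times> engel) measure)"
      by (intro borel_measurable_continuous_onI continuous_on_engel_mult continuous_on_fst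
          continuous_on_snd continuous_on_id)+
    then have "- (snd -` S \<inter> fst -` C) \<union> (\<lambda>z. fst z \<odot> snd z) -` C \<in> sets (borel :: (engel \<times> engel) measure)"
      using C(2) S(1) by (intro sets.Un borel_comp sets.Int measurable_sets_borel) auto
    moreover have "{z. Q (fst z) (snd z)} = - (snd -` S \<inter> fst -` C) \<union> (\<lambda>z. fst z \<odot> snd z) -` C"
      by (auto simp: Q_def)
    ultimately show ?thesis
      unfolding lborel_prod sets_lborel by simp
  qed
  ultimately have "AE p in lborel. AE g in lborel. Q p g"
    by (simp only: lborel_pair.AE_commute)
  then have N: "{p. \<not> (AE g in lborel. Q p g)} \<in> null_sets lebesgue"
    using AE_completion_iff_null_sets[where M=lborel and P="\<lambda>p. AE g in lborel. Q p g"]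
    by (simp add: AE_completion_iff)
  define P where "P = {p \<in> C. AE g in lborel. Q p g}"
  show ?thesis
  proof
    show "P \<subseteq> E"
      using C(1) by (auto simp: P_def)
    have "T \<union> {p. \<not> (AE g in lborel. Q p g)} \<in> null_sets lebesgue"
      using T N by (rule null_sets.Un)
    moreover have "E - P \<subseteq> T \<union> {p. \<not> (AE g in lborel. Q p g)}"
      using C(1) by (auto simp: P_def)
    ultimately show "E - P \<in> null_sets lebesgue"
      by (rule null_sets_completion_subset[rotated])
    fix p assume "p \<in> P"
    then have "AE g in lebesgue. Q p g" and p: "p \<in> C"
      by (simp_all add: P_def AE_completion_iff)
    then have "{g. \<not> Q p g} \<in> null_sets lebesgue"
      using AE_completion_iff_null_sets[where M=lborel and P="Q p"] by simp
    \<comment> \<open>Left invariance carries the null set of bad elements \<open>g\<close> to the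
      null set of bad points \<open>p \<odot> g\<close>.\<close>
    then have "{q. (- p) \<odot> q \<in> {g. \<not> Q p g}} \<in> null_sets lebesgue"
      by (rule left_translation_null_sets)
    moreover have "(\<lambda>g. p \<odot> g) ` S - E \<subseteq> {q. (- p) \<odot> q \<in> {g. \<not> Q p g}}"
      using C(1) p by (auto simp: Q_def)
    ultimately show "(\<lambda>g. p \<odot> g) ` S - E \<in> null_sets lebesgue"
      by (rule null_sets_completion_subset[rotated])
  qed
qed

section \<open>Cone-monotone open sets\<close>

text \<open>The function is \<open>g z = Inf {t. (z, t) \<in> \<Omega>}\<close>. A ball of radius
  \<open>\<delta>\<close> about \<open>(0, 1)\<close> in \<open>K\<close> generates the circular
  cone \<open>norm w < \<delta> * t\<close>, and monotonicity along this cone bounds the slope of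
  \<open>g\<close> by \<open>1 / \<delta>\<close>.\<close>

lemma cone_monotone_upper_graph:
  fixes \<Omega> K :: "('w::euclidean_space \<times> real) set"
  assumes K: "open K" "(0, 1) \<in> K" and scale: "\<And>c x. c > 0 \<Longrightarrow> x \<in> K \<Longrightarrow> c *\<^sub>R x \<in> K"
    and \<Omega>: "open \<Omega>" "\<Omega> \<noteq> {}" "\<Omega> \<noteq> UNIV" and mono: "\<And>x k. x \<in> \<Omega> \<Longrightarrow> k \<in> K \<Longrightarrow> x + k \<in> \<Omega>"
  obtains L g where "L-lipschitz_on UNIV g" "\<Omega> = {y. g (fst y) < snd y}"
proof -
  obtain \<delta> where \<delta>: "\<delta> > 0" "ball (0, 1) \<delta> \<subseteq> K"
    using openE[OF K] by metis
  have inK: "(w, t) \<in> K" if "norm w < \<delta> * t" for w :: 'w and t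
  proof -
    have "t > 0" using that \<delta>(1) by (metis less_le_trans norm_ge_zero not_less zero_less_mult_pos)
    then have "norm ((1/t) *\<^sub>R w) < \<delta>"
      using that by (simp add: pos_divide_less_eq)
    then have "((1/t) *\<^sub>R w, 1) \<in> K"
      using \<delta>(2) by (auto simp: dist_Pair_Pair)
    from scale[OF \<open>t > 0\<close> this] \<open>t > 0\<close> show ?thesis by simp
  qed
  have step: "(z', t') \<in> \<Omega>" if "(z, t) \<in> \<Omega>" "norm (z' - z) < \<delta> * (t' - t)" for z z' t t'
    using mono[OF that(1) inK[OF that(2)]] by simp
  define T where "T z = {t. (z, t) \<in> \<Omega>}" for z
  obtain z0 t0 where zt0: "(z0, t0) \<in> \<Omega>" using \<Omega>(2) by auto
  obtain z1 t1 where zt1: "(z1, t1) \<notin> \<Omega>" using \<Omega>(3) by auto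
  have ne: "T z \<noteq> {}" for z
  proof -
    have "(z, t0 + (norm (z - z0) + 1) / \<delta>) \<in> \<Omega>"
      by (rule step[OF zt0]) (use \<delta>(1) in simp)
    then show ?thesis by (auto simp: T_def)
  qed
  \<comment> \<open>A point of \<open>\<Omega>\<close> too far below \<open>(z1, t1)\<close> would
    have that excluded point in its cone.\<close>
  have bdd: "bdd_below (T z)" for z
  proof (rule bdd_belowI)
    fix t assume "t \<in> T z"
    with zt1 step[of z t z1 t1] have "\<delta> * (t1 - t) \<le> norm (z1 - z)"
      by (force simp: T_def not_less)
    then show "t1 - norm (z1 - z) / \<delta> \<le> t"
      using \<delta>(1) by (simp add: field_simps)
  qed
  define g where "g z = Inf (T z)" for z
  have g_le: "g z' \<le> g z + norm (z' - z) / \<delta>" for z z'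
  proof -
    have "g z' - norm (z' - z) / \<delta> \<le> t" if "t \<in> T z" for t
    \<comment> \<open>The cone is open, so a point strictly inside it is reached only with a margin
      \<open>\<eta>\<close>.\<close>
    proof (rule field_le_epsilon)
      fix \<eta> :: real assume "\<eta> > 0"
      have "(z', t + norm (z' - z) / \<delta> + \<eta>) \<in> \<Omega>"
        by (rule step[of z t]) (use that \<delta>(1) \<open>\<eta> > 0\<close> in \<open>auto simp: T_def distrib_left\<close>)
      then have "g z' \<le> t + norm (z' - z) / \<delta> + \<eta>"
        unfolding g_def by (intro cInf_lower bdd) (simp add: T_def)
      then show "g z' - norm (z' - z) / \<delta> \<le> t + \<eta>" by simp
    qed
    then have "g z' - norm (z' - z) / \<delta> \<le> g z"
      unfolding g_def[of z] by (intro cInf_greatest ne)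
    then show ?thesis by simp
  qed
  show ?thesis
  proof
    show "(1 / \<delta>)-lipschitz_on UNIV g"
    proof (rule lipschitz_onI)
      show "dist (g x) (g y) \<le> 1 / \<delta> * dist x y" for x y
        using g_le[of x y] g_le[of y x] by (simp add: dist_norm norm_minus_commute abs_le_iff)
    qed (use \<delta> in simp)
    show "\<Omega> = {y. g (fst y) < snd y}"
    proof safe
      fix z t assume "(z, t) \<in> \<Omega>"
      \<comment> \<open>Openness leaves room below \<open>(z, t)\<close>, so the infimum is not
        attained and the inequality is strict.\<close>
      then obtain e where e: "e > 0" "ball (z, t) e \<subseteq> \<Omega>"
        using openE[OF \<Omega>(1)] by metis
      then have "(z, t - e/2) \<in> \<Omega>"
        by (auto simp: dist_Pair_Pair dist_real_def)
      then have "g z \<le> t - e/2"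
        unfolding g_def by (intro cInf_lower bdd) (simp add: T_def)
      with e(1) show "g (fst (z, t)) < snd (z, t)" by simp
    next
      fix z t assume "g (fst (z, t)) < snd (z, t)"
      then obtain t' where "t' \<in> T z" "t' < t"
        using cInf_lessD[OF ne] unfolding g_def by auto
      then show "(z, t) \<in> \<Omega>"
        using step[of z t' z t] \<delta>(1) by (simp add: T_def)
    qed
  qed
qed

text \<open>The graph is the image of the hyperplane \<open>t = 0\<close> under a Lipschitz map of
  the whole space into itself, and such maps preserve null sets.\<close>

lemma negligible_lipschitz_graph:
  fixes g :: "'w::euclidean_space \<Rightarrow> real"
  assumes "L-lipschitz_on UNIV g"
  shows "negligible {y. snd y = g (fst y)}"
proof -
  let ?S = "{y :: 'w \<times> real. (0, 1) \<bullet> y = 0}"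
  have "negligible ((\<lambda>y. (fst y, g (fst y))) ` ?S)"
  proof (rule negligible_locally_Lipschitz_image)
    show "negligible ?S" by (rule negligible_hyperplane) (simp add: zero_prod_def)
    fix x :: "'w \<times> real"
    have "norm ((fst y, g (fst y)) - (fst x, g (fst x))) \<le> (1 + L) * norm (y - x)" for y
    proof -
      have "norm ((fst y, g (fst y)) - (fst x, g (fst x))) \<le> norm (fst y - fst x) + \<bar>g (fst y) - g (fst x)\<bar>"
        using norm_Pair_le[of "fst y - fst x" "g (fst y) - g (fst x)"] by simp
      also have "\<dots> \<le> (1 + L) * norm (fst (y - x))"
        using lipschitz_onD[OF assms, of "fst y" "fst x"] by (simp add: dist_norm distrib_right)
      also have "\<dots> \<le> (1 + L) * norm (y - x)"
        using lipschitz_on_nonneg[OF assms] norm_fst_le[of "fst (y - x)" "snd (y - x)"]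
        by (intro mult_left_mono) (simp_all only: prod.collapse add_nonneg_nonneg zero_le_one)
      finally show ?thesis .
    qed
    then show "\<exists>T B. open T \<and> x \<in> T \<and>
        (\<forall>y\<in>?S \<inter> T. norm ((fst y, g (fst y)) - (fst x, g (fst x))) \<le> B * norm (y - x))"
      by (intro exI[of _ UNIV] exI[of _ "1 + L"]) simp
  qed simp
  moreover have "{y. snd y = g (fst y)} = (\<lambda>y. (fst y, g (fst y))) ` ?S"
  proof (intro equalityI subsetI)
    fix y assume "y \<in> {y. snd y = g (fst y)}"
    then show "y \<in> (\<lambda>y. (fst y, g (fst y))) ` ?S"
      by (intro image_eqI[of _ _ "(fst y, 0)"]) (simp_all add: prod_eq_iff)
  qed auto
  ultimately show ?thesis by simp
qed

lemma frontier_strict_superlevel: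
  fixes f h :: "'a::topological_space \<Rightarrow> real"
  assumes "continuous_on UNIV f" "continuous_on UNIV h"
  shows "frontier {y. f y < h y} \<subseteq> {y. h y = f y}"
proof -
  have "closed {y. f y \<le> h y}" "open {y. f y < h y}"
    using assms by (intro closed_Collect_le open_Collect_less; simp)+
  then have "closure {y. f y < h y} \<subseteq> {y. f y \<le> h y}" "interior {y. f y < h y} = {y. f y < h y}"
    by (simp_all add: closure_minimal interior_open Collect_mono)
  then show ?thesis
    by (auto simp: frontier_def)
qed

text \<open>A rotation takes \<open>e\<close> to a multiple of the fourth axis; the last coordinate
  is then divided by \<open>norm e\<close>.\<close>

lemma linear_coordinates_exist:
  fixes e :: "real^4"
  assumes "e \<noteq> 0"
  obtains A :: "real^4 \<Rightarrow> (real^3) \<times> real" where "linear A" "bij A" "A e = (0, 1)"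
proof -
  have "norm e \<noteq> 0" using assms by simp
  have "norm e = norm (norm e *\<^sub>R (axis 4 1 :: real^4))"
    by simp
  then obtain R :: "real^4 \<Rightarrow> real^4" where R: "orthogonal_transformation R" "R e = norm e *\<^sub>R axis 4 1"
    by (rule orthogonal_transformation_exists)
  define A0 :: "real^4 \<Rightarrow> (real^3) \<times> real"
    where "A0 x = (vector [x$1, x$2, x$3], x$4 / norm e)" for x
  have "linear A0"
    by (rule linearI) (simp_all add: A0_def vec_eq_iff forall_3 add_divide_distrib)
  moreover have "bij A0"
    by (rule bij_betw_byWitness[where f'="\<lambda>(w, t). vector [w$1, w$2, w$3, t * norm e]"])
      (auto simp: A0_def vec_eq_iff forall_3 forall_4 \<open>norm e \<noteq> 0\<close> simp del: norm_eq_zero)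
  moreover have "A0 (R e) = (0, 1)"
    using assms by (simp add: R(2) A0_def vec_eq_iff forall_3 axis_def)
  ultimately show ?thesis
    using R(1) that[of "A0 \<circ> R"]
    by (simp add: linear_compose orthogonal_transformation_linear bij_comp orthogonal_transformation_bij)
qed

text \<open>Linear coordinates that send \<open>e\<close> to \<open>(0, 1)\<close> bring
  \<open>\<Omega>\<close> into the form of a global upper graph, so \<open>U = UNIV\<close> serves
  at every boundary point. The empty set and the whole space have empty frontier.\<close>

lemma cone_monotone_lipschitz_domain:
  fixes \<Omega> K :: "(real^4) set"
  assumes K: "open K" "e \<in> K" "e \<noteq> 0" and scale: "\<And>c x. c > 0 \<Longrightarrow> x \<in> K \<Longrightarrow> c *\<^sub>R x \<in> K"
    and \<Omega>: "open \<Omega>" and mono: "\<And>x k. x \<in> \<Omega> \<Longrightarrow> k \<in> K \<Longrightarrow> x + k \<in> \<Omega>"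
  shows "locally_lipschitz_upper_graph \<Omega>" "negligible (frontier \<Omega>)"
proof -
  have "locally_lipschitz_upper_graph \<Omega> \<and> negligible (frontier \<Omega>)"
  proof (cases "\<Omega> = {} \<or> \<Omega> = UNIV")
    case True
    then show ?thesis by (auto simp: locally_lipschitz_upper_graph_def)
  next
    case False
    obtain A :: "real^4 \<Rightarrow> (real^3) \<times> real" where A: "linear A" "bij A" "A e = (0, 1)"
      using linear_coordinates_exist[OF K(3)] by metis
    have surj: "surj A" and inj: "inj A" using A(2) by (simp_all add: bij_def)
    obtain L g where g: "L-lipschitz_on UNIV g" and eq: "A ` \<Omega> = {y. g (fst y) < snd y}"
    proof (rule cone_monotone_upper_graph[of "A ` K" "A ` \<Omega>"])
      show "open (A ` K)" "open (A ` \<Omega>)"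
        using K(1) \<Omega> A(1) surj by (auto intro: open_surjective_linear_image)
      show "(0, 1) \<in> A ` K" using K(2) A(3) by force
      show "c *\<^sub>R y \<in> A ` K" if "c > 0" "y \<in> A ` K" for c y
        using that scale by (auto simp: linear_cmul[OF A(1), symmetric])
      show "A ` \<Omega> \<noteq> {}" "A ` \<Omega> \<noteq> UNIV"
        using False inj_image_eq_iff[OF inj, of \<Omega> UNIV] surj by auto
      show "y + k \<in> A ` \<Omega>" if "y \<in> A ` \<Omega>" "k \<in> A ` K" for y k
        using that mono by (auto simp: linear_add[OF A(1), symmetric])
    qed
    have \<Omega>_eq: "\<Omega> = {y. g (fst (A y)) < snd (A y)}"
    proof -
      have "y \<in> \<Omega> \<longleftrightarrow> A y \<in> A ` \<Omega>" for y
        using inj by (simp add: inj_image_mem_iff)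
      then show ?thesis unfolding eq by auto
    qed
    have "locally_lipschitz_upper_graph \<Omega>"
      unfolding locally_lipschitz_upper_graph_def
    proof (intro ballI exI conjI)
      show "\<Omega> \<inter> UNIV = {y \<in> UNIV. snd (A y) > g (fst (A y))}"
        using \<Omega>_eq by simp
    qed (use A g in auto)
    moreover have "negligible (frontier \<Omega>)"
    proof -
      obtain A' where A': "linear A'" "A' \<circ> A = id"
        using linear_injective_left_inverse[OF A(1) inj] by metis
      have cA: "continuous_on UNIV A"
        by (rule linear_continuous_on) (use A(1) linear_conv_bounded_linear in blast)
      have "continuous_on UNIV (\<lambda>y. g (fst (A y)))"
        by (rule continuous_on_compose2[OF lipschitz_on_continuous_on[OF g] continuous_on_fst[OF cA]]) simp
      then have "frontier \<Omega> \<subseteq> {y. snd (A y) = g (fst (A y))}"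
        unfolding \<Omega>_eq by (rule frontier_strict_superlevel[OF _ continuous_on_snd[OF cA]])
      also have "\<dots> \<subseteq> A' ` {y. snd y = g (fst y)}"
      proof
        fix y assume "y \<in> {y. snd (A y) = g (fst (A y))}"
        moreover have "y = A' (A y)" using A'(2) by (metis comp_apply id_apply)
        ultimately show "y \<in> A' ` {y. snd y = g (fst y)}" by blast
      qed
      finally have "frontier \<Omega> \<subseteq> A' ` {y. snd y = g (fst y)}" .
      moreover have "negligible (A' ` {y. snd y = g (fst y)})"
        using A'(1) by (intro negligible_differentiable_image_negligible negligible_lipschitz_graph[OF g]
            linear_imp_differentiable_on) simp_all
      ultimately show ?thesis
        using negligible_subset by metis
    qed
    ultimately show ?thesis by simp
  qed
  then show "locally_lipschitz_upper_graph \<Omega>" "negligible (frontier \<Omega>)"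
    by simp_all
qed

section \<open>Coordinates adapted to the splitting\<close>

text \<open>The point is \<open>n exp(u Y')\<close> with \<open>u = x$1\<close>,
  \<open>Y' = X1 + \<beta> X2\<close> and \<open>n\<close> in the abelian subgroup of
  \<open>X2, X3, X4\<close>.\<close>

definition engel_chart :: "real \<Rightarrow> engel \<Rightarrow> engel" where
  "engel_chart \<beta> x = vector [0, x$2, x$3, x$4] \<odot> (x$1 *\<^sub>R vector [1, \<beta>, 0, 0])"

definition engel_chart_inv :: "real \<Rightarrow> engel \<Rightarrow> engel" where
  "engel_chart_inv \<beta> p = vector [p$1, p$2 - \<beta> * p$1,
     p$3 + p$1 * (p$2 - \<beta> * p$1) / 2,
     p$4 + p$1 * p$3 / 2 + p$1 * p$1 * (p$2 - \<beta> * p$1) / 6]"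

text \<open>On the span of \<open>X2, X3, X4\<close> this is \<open>exp (u ad Y')\<close>, that is,
  conjugation by \<open>exp(u Y')\<close>; the first coordinate is kept.\<close>

definition engel_shear :: "real \<Rightarrow> engel \<Rightarrow> engel" where
  "engel_shear u k = vector [k$1, k$2, k$3 + u * k$2, k$4 + u * k$3 + u\<^sup>2 * k$2 / 2]"

lemma engel_chart_nth [simp]:
  "engel_chart \<beta> x $ 1 = x$1"
  "engel_chart \<beta> x $ 2 = x$2 + \<beta> * x$1"
  "engel_chart \<beta> x $ 3 = x$3 - x$1 * x$2 / 2"
  "engel_chart \<beta> x $ 4 = x$4 - x$1 * x$3 / 2 + x$1 * x$1 * x$2 / 12"
  by (simp_all add: engel_chart_def engel_mult_def mult.commute mult.left_commute)

lemma engel_chart_inverse [simp]: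
  "engel_chart_inv \<beta> (engel_chart \<beta> x) = x" "engel_chart \<beta> (engel_chart_inv \<beta> p) = p"
  by (simp_all add: vec_eq_iff forall_4 engel_chart_inv_def) (simp_all add: field_simps)

text \<open>Moving \<open>exp(u Y')\<close> past the second normal factor conjugates that factor. In
  the abelian subgroup the results add, so left translations are affine in the chart.\<close>

lemma engel_chart_mult:
  "engel_chart \<beta> x \<odot> engel_chart \<beta> k = engel_chart \<beta> (x + engel_shear (x$1) k)"
  by (simp add: vec_eq_iff forall_4 engel_mult_def engel_shear_def)
    (simp add: field_simps power2_eq_square)

lemma engel_shear_inverse: "engel_shear u (engel_shear (- u) k) = k"
  by (simp add: vec_eq_iff forall_4 engel_shear_def) (simp add: field_simps power2_eq_square)

lemmas C_k_polynomial = C_k_add C_k_diff C_k_mult C_k_nth C_k_const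

lemma C_k_engel_chart: "C_k k (engel_chart \<beta>)"
proof (rule C_k_vec)
  have "C_k k (\<lambda>x. engel_chart \<beta> x $ 1)" "C_k k (\<lambda>x. engel_chart \<beta> x $ 2)"
    "C_k k (\<lambda>x. engel_chart \<beta> x $ 3)" "C_k k (\<lambda>x. engel_chart \<beta> x $ 4)"
    unfolding engel_chart_nth divide_inverse by (rule C_k_polynomial)+
  then show "C_k k (\<lambda>x. engel_chart \<beta> x $ i)" for i
    using exhaust_4[of i] by auto
qed

lemma C_k_engel_chart_inv: "C_k k (engel_chart_inv \<beta>)"
proof (rule C_k_vec)
  have "C_k k (\<lambda>x. engel_chart_inv \<beta> x $ 1)" "C_k k (\<lambda>x. engel_chart_inv \<beta> x $ 2)"
    "C_k k (\<lambda>x. engel_chart_inv \<beta> x $ 3)" "C_k k (\<lambda>x. engel_chart_inv \<beta> x $ 4)"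
    unfolding engel_chart_inv_def vector_4_nth divide_inverse by (rule C_k_polynomial)+
  then show "C_k k (\<lambda>x. engel_chart_inv \<beta> x $ i)" for i
    using exhaust_4[of i] by auto
qed

lemma diffeomorphism_engel_chart_inv: "diffeomorphism (engel_chart_inv \<beta>)"
proof -
  have "inv (engel_chart_inv \<beta>) = engel_chart \<beta>"
    by (rule inv_equality) simp_all
  moreover have "bij (engel_chart_inv \<beta>)"
    by (rule bij_betw_byWitness[where f'="engel_chart \<beta>"]) auto
  ultimately show ?thesis
    by (simp add: diffeomorphism_def smooth_def C_k_engel_chart C_k_engel_chart_inv)
qed

lemma engel_chart_cone_translate:
  assumes "\<And>u k. k \<in> K \<Longrightarrow> engel_shear u k \<in> K"
  shows "(\<lambda>g. p \<odot> g) ` engel_chart \<beta> ` K = engel_chart \<beta> ` (+) (engel_chart_inv \<beta> p) ` K"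
proof -
  let ?x = "engel_chart_inv \<beta> p"
  have eq: "p \<odot> engel_chart \<beta> k = engel_chart \<beta> (?x + engel_shear (?x$1) k)" for k
    using engel_chart_mult[of \<beta> ?x k] by simp
  have "engel_shear (?x$1) ` K = K"
  proof (intro equalityI subsetI)
    fix k assume "k \<in> K"
    then show "k \<in> engel_shear (?x$1) ` K"
      using assms by (intro image_eqI[of _ _ "engel_shear (- (?x$1)) k"]) (simp_all add: engel_shear_inverse)
  qed (use assms in auto)
  then have "(+) ?x ` K = (\<lambda>k. ?x + engel_shear (?x$1) k) ` K"
    by (metis image_image)
  then show ?thesis
    by (simp add: image_image eq)
qed

text \<open>The union \<open>\<Omega>\<close> of the cones at chart images of good points is
  monotone along \<open>K\<close> because \<open>K\<close> is closed under addition. Its chart image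
  exceeds \<open>E\<close> by a null set, and good points outside that image lie over the null
  frontier of \<open>\<Omega>\<close>.\<close>

lemma lipschitz_domain_if_expanding_cone:
  assumes E: "E \<in> sets vol_engel"
    and K: "open K" "e \<in> K" "e \<noteq> 0"
    and add: "\<And>x y. x \<in> K \<Longrightarrow> y \<in> K \<Longrightarrow> x + y \<in> K"
    and scale: "\<And>c x. c > 0 \<Longrightarrow> x \<in> K \<Longrightarrow> c *\<^sub>R x \<in> K"
    and shear: "\<And>u k. k \<in> K \<Longrightarrow> engel_shear u k \<in> K"
    and exp: "\<And>k. k \<in> K \<Longrightarrow> expanding E (engel_chart \<beta> k)"
  shows "\<exists>E'. lipschitz_euclidean_domain E' \<and> sym_diff E E' \<in> null_sets vol_engel"
proof -
  let ?\<Phi> = "engel_chart \<beta>" and ?\<Psi> = "engel_chart_inv \<beta>"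
  have "?\<Phi> ` K = ?\<Psi> -` K"
    by (auto intro: image_eqI[of _ _ "?\<Psi> _"])
  then have "open (?\<Phi> ` K)"
    using K(1) C_k_imp_continuous[OF C_k_engel_chart_inv] by (simp add: open_vimage)
  then obtain P where P: "P \<subseteq> E" "E - P \<in> null_sets lebesgue"
    "\<And>p. p \<in> P \<Longrightarrow> (\<lambda>g. p \<odot> g) ` ?\<Phi> ` K - E \<in> null_sets lebesgue"
    by (rule expanding_conull_points[OF E]) (use exp in auto)
  define D where "D p = (+) (?\<Psi> p) ` K" for p
  define \<Omega> where "\<Omega> = (\<Union>p\<in>P. D p)"
  have D: "open (D p)" for p
    unfolding D_def by (rule open_translation[OF K(1)])
  have D_null: "?\<Phi> ` D p - E \<in> null_sets lebesgue" if "p \<in> P" for p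
  proof -
    have "(\<lambda>g. p \<odot> g) ` ?\<Phi> ` K = ?\<Phi> ` D p"
      unfolding D_def by (rule engel_chart_cone_translate) (rule shear)
    with P(3)[OF that] show ?thesis by simp
  qed
  have \<Omega>: "open \<Omega>"
    unfolding \<Omega>_def using D by blast
  have mono: "x + k \<in> \<Omega>" if xk: "x \<in> \<Omega>" "k \<in> K" for x k
  proof -
    obtain p k' where "p \<in> P" "k' \<in> K" "x = ?\<Psi> p + k'"
      using xk(1) by (auto simp: \<Omega>_def D_def)
    then have "?\<Psi> p + (k' + k) \<in> D p" "x + k = ?\<Psi> p + (k' + k)"
      using add[of k' k] xk(2) by (auto simp: D_def)
    then show ?thesis
      using \<open>p \<in> P\<close> unfolding \<Omega>_def by (simp only: UN_I)
  qed
  have lip: "locally_lipschitz_upper_graph \<Omega>" and front: "negligible (frontier \<Omega>)"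
    using cone_monotone_lipschitz_domain[OF K scale \<Omega> mono] by blast+
  define E' where "E' = ?\<Phi> ` \<Omega>"
  have "?\<Psi> ` E' = \<Omega>"
    by (simp add: E'_def image_image)
  then have "lipschitz_euclidean_domain E'"
    unfolding lipschitz_euclidean_domain_def
    using lip \<Omega> diffeomorphism_engel_chart_inv[of \<beta>] by metis
  moreover have "E' - E \<in> null_sets lebesgue"
  proof -
    \<comment> \<open>The union over \<open>P\<close> may be uncountable; the Lindelof property
      leaves countably many null sets to add up.\<close>
    obtain J where J: "J \<subseteq> P" "countable J" "(\<Union>p\<in>J. D p) = (\<Union>p\<in>P. D p)"
      using D by (rule countable_subfamily_same_Union)
    have "E' - E = (\<Union>p\<in>J. ?\<Phi> ` D p - E)"
      unfolding E'_def \<Omega>_def J(3)[symmetric] by blast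
    also have "\<dots> \<in> null_sets lebesgue"
      using J(1) by (intro null_sets_UN' J(2) D_null) blast
    finally show ?thesis .
  qed
  moreover have "E - E' \<in> null_sets lebesgue"
  proof -
    have diff: "?\<Phi> differentiable_on S" for S
      using C_k_engel_chart[of "Suc 0" \<beta>]
      by (auto simp: C_k.simps differentiable_on_def intro: differentiable_at_withinI)
    have "negligible (?\<Phi> ` frontier \<Omega>)"
      by (rule negligible_differentiable_image_negligible[OF _ front diff]) simp
    then have "(E - P) \<union> ?\<Phi> ` frontier \<Omega> \<in> null_sets lebesgue"
      using P(2) by (simp add: negligible_iff_null_sets null_sets.Un)
    moreover have "E - E' \<subseteq> (E - P) \<union> ?\<Phi> ` frontier \<Omega>"
    proof
      fix p assume p: "p \<in> E - E'"
      show "p \<in> (E - P) \<union> ?\<Phi> ` frontier \<Omega>"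
      proof (cases "p \<in> P")
        case True
        \<comment> \<open>The apex of a cone is the limit of the points \<open>e / (n + 1)\<close>
          inside it, so every good point lies over the closure of \<open>\<Omega>\<close>.\<close>
        have "?\<Psi> p + (1 / real (Suc n)) *\<^sub>R e \<in> \<Omega>" for n
          using True scale[OF _ K(2), of "1 / real (Suc n)"] unfolding \<Omega>_def D_def by auto
        moreover have "(\<lambda>n. ?\<Psi> p + (1 / real (Suc n)) *\<^sub>R e) \<longlonglongrightarrow> ?\<Psi> p + 0 *\<^sub>R e"
          by (intro tendsto_intros LIMSEQ_Suc[OF lim_1_over_n])
        then have "(\<lambda>n. ?\<Psi> p + (1 / real (Suc n)) *\<^sub>R e) \<longlonglongrightarrow> ?\<Psi> p"
          by (simp only: scaleR_zero_left add_0_right)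
        ultimately have "?\<Psi> p \<in> closure \<Omega>"
          unfolding closure_sequential by (intro exI conjI allI)
        moreover have "?\<Psi> p \<notin> \<Omega>"
          using p image_eqI[of p ?\<Phi> "?\<Psi> p" \<Omega>] by (auto simp: E'_def)
        ultimately have "?\<Psi> p \<in> frontier \<Omega>"
          using \<Omega> by (simp add: frontier_def interior_open)
        then show ?thesis
          using image_eqI[of p ?\<Phi> "?\<Psi> p" "frontier \<Omega>"] by simp
      qed (use p in simp)
    qed
    ultimately show ?thesis
      by (rule null_sets_completion_subset[rotated])
  qed
  ultimately show ?thesis
    by (intro exI[of _ E']) (simp add: null_sets.Un)
qed

section \<open>Expanding cones for the two positions of the annihilating field\<close>

lemma engel_chart_exp:
  "engel_chart \<beta> (vector [t, 0, 0, 0]) = t *\<^sub>R (axis 1 1 + \<beta> *\<^sub>R axis 2 1)"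
  "engel_chart \<beta> (vector [0, t, 0, 0]) = t *\<^sub>R axis 2 1"
  by (simp_all add: vec_eq_iff forall_4 axis_def)

lemma engel_chart_mult_vector:
  "engel_chart \<beta> (vector [a, b, c, d]) \<odot> engel_chart \<beta> (vector [a', b', c', d'])
    = engel_chart \<beta> (vector [a + a', b + b', c + c' + a * b', d + d' + a * c' + a\<^sup>2 * b' / 2])"
  unfolding engel_chart_mult
  by (rule arg_cong[where f="engel_chart \<beta>"]) (simp add: vec_eq_iff forall_4 engel_shear_def)

text \<open>
  If \<open>Y = X\<^sub>1 + \<beta>X\<^sub>2\<close> annihilates the indicator of \<open>E\<close>, conjugating \<open>exp(sX\<^sub>2)\<close> by the flow of \<open>Y\<close>
  gives the curve \<open>s(X\<^sub>2 + tX\<^sub>3 + t\<^sup>2/2 X\<^sub>4)\<close>, whose points at two values of \<open>t\<close> have sums that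
  already fill the interior of a quadratic cone.
\<close>

lemma lipschitz_domain_transversal_case:
  assumes E: "E \<in> sets vol_engel" and \<sigma>: "\<bar>\<sigma>\<bar> = 1"
    and Y: "indicator_deriv_zero (axis 1 1 + \<beta> *\<^sub>R axis 2 1) E"
    and X: "indicator_deriv_nonneg (\<sigma> *\<^sub>R axis 2 1) E"
  shows "\<exists>E'. lipschitz_euclidean_domain E' \<and> sym_diff E E' \<in> null_sets vol_engel"
proof -
  \<comment> \<open>The form \<open>(k$3)\<^sup>2 - 2 * k$2 * k$4\<close> is invariant under shears
    and vanishes on the conjugated curve. The first coordinate is free because the flow of
    \<open>Y\<close> is expanding in both directions.\<close>
  define K :: "engel set" where "K = {k. 0 < \<sigma> * k$2 \<and> (k$3)\<^sup>2 < 2 * k$2 * k$4}"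
  have \<sigma>\<sigma>: "\<sigma> * \<sigma> = 1" using \<sigma> by (metis abs_mult_self_eq mult_1)
  have expY: "expanding E (engel_chart \<beta> (vector [t, 0, 0, 0]))" for t
    unfolding engel_chart_exp by (rule expanding_subgroup[OF E Y])
  have expX: "expanding E (engel_chart \<beta> (vector [0, s, 0, 0]))" if "\<sigma> * s \<ge> 0" for s
  proof -
    have "(\<sigma> * s) * \<sigma> = (\<sigma> * \<sigma>) * s" by (simp only: mult_ac)
    with expanding_flow[OF E X that] show ?thesis
      by (simp add: engel_chart_exp \<sigma>\<sigma>)
  qed
  have conj: "expanding E (engel_chart \<beta> (vector [0, s, t * s, t\<^sup>2 * s / 2]))" if "\<sigma> * s \<ge> 0" for s t
    using expanding_mult[OF expanding_mult[OF expY[of t] expX[OF that]] expY[of "- t"]]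
    by (simp add: engel_chart_mult_vector)
  show ?thesis
  proof (rule lipschitz_domain_if_expanding_cone[OF E, where K=K and e="vector [0, \<sigma>, 0, \<sigma>]" and \<beta>=\<beta>])
    show "open K"
      unfolding K_def by (intro open_Collect_conj open_Collect_less continuous_intros)
    show "vector [0, \<sigma>, 0, \<sigma>] \<in> K"
      using \<sigma>\<sigma> by (simp add: K_def mult.assoc)
    show "vector [0, \<sigma>, 0, \<sigma>] \<noteq> (0 :: engel)"
      using \<sigma> by (auto simp: vec_eq_iff forall_4)
    show "x + y \<in> K" if xy: "x \<in> K" "y \<in> K" for x y
    proof -
      have pos: "0 < x$2 * y$2"
      proof -
        have "0 < (\<sigma> * x$2) * (\<sigma> * y$2)" using xy by (simp add: K_def)
        also have "\<dots> = (\<sigma> * \<sigma>) * (x$2 * y$2)" by (simp add: mult_ac)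
        finally show ?thesis by (simp add: \<sigma>\<sigma>)
      qed
      \<comment> \<open>Convexity needs a bound for the mixed term \<open>2 * x$3 * y$3\<close>.
        Scaled by the positive number \<open>x$2 * y$2\<close>, it follows from the two cone
        inequalities and \<open>2ab \<le> a^2 + b^2\<close>.\<close>
      have "(x$3 * y$2)\<^sup>2 + (y$3 * x$2)\<^sup>2 \<le> (2 * x$2 * x$4) * (y$2)\<^sup>2 + (2 * y$2 * y$4) * (x$2)\<^sup>2"
        unfolding power_mult_distrib using xy by (intro add_mono mult_right_mono) (auto simp: K_def)
      moreover have "2 * (x$3 * y$2) * (y$3 * x$2) \<le> (x$3 * y$2)\<^sup>2 + (y$3 * x$2)\<^sup>2"
        by (rule sum_squares_bound)
      ultimately have "(x$2 * y$2) * (2 * x$3 * y$3) \<le> (x$2 * y$2) * (2 * x$2 * y$4 + 2 * y$2 * x$4)"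
        by (simp add: algebra_simps power2_eq_square)
      then have "2 * x$3 * y$3 \<le> 2 * x$2 * y$4 + 2 * y$2 * x$4"
        using pos by (rule mult_left_le_imp_le)
      then show ?thesis
        using xy by (simp add: K_def power2_sum algebra_simps)
    qed
    show "c *\<^sub>R x \<in> K" if "c > 0" "x \<in> K" for c x
    proof -
      have "c\<^sup>2 * (x$3)\<^sup>2 < c\<^sup>2 * (2 * x$2 * x$4)"
        using that by (intro mult_strict_left_mono) (simp_all add: K_def)
      then have "(c * x$3)\<^sup>2 < 2 * (c * x$2) * (c * x$4)"
        by (simp add: power2_eq_square mult_ac)
      moreover have "0 < c * (\<sigma> * x$2)"
        using that by (simp add: K_def)
      ultimately show ?thesis
        by (simp add: K_def mult.left_commute[of \<sigma>])
    qed
    show "engel_shear u k \<in> K" if "k \<in> K" for u k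
      using that by (simp add: K_def engel_shear_def power2_sum) (simp add: power2_eq_square algebra_simps)
    show "expanding E (engel_chart \<beta> k)" if k: "k \<in> K" for k
    proof -
      \<comment> \<open>The coordinate \<open>k$2\<close> is split into equal halves, placed on the
        curve at the parameters \<open>m + \<delta>\<close> and \<open>m - \<delta>\<close>. Their
        mean must be \<open>k$3 / k$2\<close> and their mean square \<open>2 * k$4 / k$2\<close>;
        membership in \<open>K\<close> makes \<open>\<delta>\<close> real.\<close>
      define m where "m = k$3 / k$2"
      define \<delta> where "\<delta> = sqrt (2 * k$4 / k$2 - m\<^sup>2)"
      have nz: "k$2 \<noteq> 0" using k by (auto simp: K_def)
      have "m\<^sup>2 = (k$3)\<^sup>2 / (k$2)\<^sup>2" by (simp add: m_def power_divide)
      also have "\<dots> \<le> (2 * k$2 * k$4) / (k$2)\<^sup>2"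
        using k by (intro divide_right_mono) (simp_all add: K_def)
      also have "\<dots> = 2 * k$4 / k$2" using nz by (simp add: power2_eq_square)
      finally have \<delta>: "\<delta>\<^sup>2 = 2 * k$4 / k$2 - m\<^sup>2" by (simp add: \<delta>_def)
      let ?s = "k$2 / 2"
      have s: "\<sigma> * ?s \<ge> 0" using k by (simp add: K_def)
      have k3: "(m + \<delta>) * ?s + (m - \<delta>) * ?s = k$3"
        using nz by (simp add: m_def algebra_simps)
      have "(m + \<delta>)\<^sup>2 * ?s / 2 + (m - \<delta>)\<^sup>2 * ?s / 2 = (m\<^sup>2 + \<delta>\<^sup>2) * k$2 / 2"
        by (simp add: power2_eq_square field_simps)
      also have "\<dots> = k$4"
        using nz by (simp add: \<delta>)
      finally have k4: "(m + \<delta>)\<^sup>2 * ?s / 2 + (m - \<delta>)\<^sup>2 * ?s / 2 = k$4" .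
      have "expanding E (engel_chart \<beta> (vector [k$1, ?s + ?s, (m + \<delta>) * ?s + (m - \<delta>) * ?s,
          (m + \<delta>)\<^sup>2 * ?s / 2 + (m - \<delta>)\<^sup>2 * ?s / 2]))"
        using expanding_mult[OF expanding_mult[OF conj[OF s] conj[OF s]] expY[of "k$1"],
            of "m + \<delta>" "m - \<delta>"]
        unfolding engel_chart_mult_vector by simp
      moreover have "vector [k$1, ?s + ?s, (m + \<delta>) * ?s + (m - \<delta>) * ?s,
          (m + \<delta>)\<^sup>2 * ?s / 2 + (m - \<delta>)\<^sup>2 * ?s / 2] = k"
        unfolding k3 k4 by (simp add: vec_eq_iff forall_4)
      ultimately show ?thesis by simp
    qed
  qed
qed

text \<open>
  If \<open>X\<^sub>2\<close> annihilates the indicator of \<open>E\<close>, then so do \<open>X\<^sub>3\<close> and \<open>X\<^sub>4\<close>, and \<open>E\<close> is a half space.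
\<close>

lemma lipschitz_domain_vertical_case:
  assumes E: "E \<in> sets vol_engel" and \<sigma>: "\<bar>\<sigma>\<bar> = 1"
    and Y: "indicator_deriv_zero (axis 2 1) E"
    and X: "indicator_deriv_nonneg (\<sigma> *\<^sub>R axis 1 1) E"
  shows "\<exists>E'. lipschitz_euclidean_domain E' \<and> sym_diff E E' \<in> null_sets vol_engel"
proof -
  define K :: "engel set" where "K = {k. 0 < \<sigma> * k$1}"
  have \<sigma>\<sigma>: "\<sigma> * \<sigma> = 1" using \<sigma> by (metis abs_mult_self_eq mult_1)
  have expY: "expanding E (engel_chart 0 (vector [0, t, 0, 0]))" for t
    unfolding engel_chart_exp by (rule expanding_subgroup[OF E Y])
  have expX: "expanding E (engel_chart 0 (vector [r, 0, 0, 0]))" if "\<sigma> * r \<ge> 0" for r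
  proof -
    have "(\<sigma> * r) * \<sigma> = (\<sigma> * \<sigma>) * r" by (simp only: mult_ac)
    with expanding_flow[OF E X that] show ?thesis
      by (simp add: engel_chart_exp \<sigma>\<sigma>)
  qed
  \<comment> \<open>This is \<open>exp(rX1)\<close> conjugated by \<open>exp(tX2)\<close>, written
    in the chart.\<close>
  have conj: "expanding E (engel_chart 0 (vector [r, 0, - (r * t), - (r\<^sup>2 * t / 2)]))" if "\<sigma> * r \<ge> 0" for r t
    using expanding_mult[OF expanding_mult[OF expY[of t] expX[OF that]] expY[of "- t"]]
    by (simp add: engel_chart_mult_vector)
  show ?thesis
  proof (rule lipschitz_domain_if_expanding_cone[OF E, where K=K and e="vector [\<sigma>, 0, 0, 0]" and \<beta>=0])
    show "open K"
      unfolding K_def by (intro open_Collect_less continuous_intros)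
    show "vector [\<sigma>, 0, 0, 0] \<in> K"
      using \<sigma>\<sigma> by (simp add: K_def)
    show "vector [\<sigma>, 0, 0, 0] \<noteq> (0 :: engel)"
      using \<sigma> by (auto simp: vec_eq_iff forall_4)
    show "x + y \<in> K" if "x \<in> K" "y \<in> K" for x y
      using that by (simp add: K_def distrib_left)
    show "c *\<^sub>R x \<in> K" if "c > 0" "x \<in> K" for c x
      using that by (simp add: K_def mult.left_commute[of \<sigma>])
    show "engel_shear u k \<in> K" if "k \<in> K" for u k
      using that by (simp add: K_def engel_shear_def)
    show "expanding E (engel_chart 0 k)" if k: "k \<in> K" for k
    proof -
      \<comment> \<open>In the product of two conjugates with the same \<open>r\<close>, the
        coordinates \<open>k$3\<close> and \<open>k$4\<close> prescribe \<open>t + t'\<close> and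
        \<open>t + 3 * t'\<close>. The shear by the first factor contributes the extra
        \<open>2 * t'\<close>, which makes the system solvable. A left factor
        \<open>exp(k$2 X2)\<close> then sets the second coordinate alone.\<close>
      define r where "r = k$1 / 2"
      define t' where "t' = (k$3 / r - 2 * k$4 / r\<^sup>2) / 2"
      define t where "t = - (k$3 / r) - t'"
      have r: "r \<noteq> 0" "\<sigma> * r \<ge> 0" using k by (auto simp: K_def r_def)
      have k3: "- (r * t) + - (r * t') = k$3"
        using r(1) by (simp add: t_def algebra_simps)
      have "- (r\<^sup>2 * t / 2) + - (r\<^sup>2 * t' / 2) + r * - (r * t') = - r\<^sup>2 * (t + t' + 2 * t') / 2"
        by (simp add: power2_eq_square algebra_simps)
      also have "t + t' + 2 * t' = - (2 * k$4 / r\<^sup>2)"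
        by (simp add: t_def t'_def diff_divide_distrib)
      also have "- r\<^sup>2 * - (2 * k$4 / r\<^sup>2) / 2 = k$4"
        using r(1) by simp
      finally have k4: "- (r\<^sup>2 * t / 2) + - (r\<^sup>2 * t' / 2) + r * - (r * t') = k$4" .
      have "expanding E (engel_chart 0 (vector [r + r, k$2, - (r * t) + - (r * t'),
          - (r\<^sup>2 * t / 2) + - (r\<^sup>2 * t' / 2) + r * - (r * t')]))"
        using expanding_mult[OF expY[of "k$2"] expanding_mult[OF conj[OF r(2)] conj[OF r(2)]], of t t']
        unfolding engel_chart_mult_vector by simp
      moreover have "vector [r + r, k$2, - (r * t) + - (r * t'),
          - (r\<^sup>2 * t / 2) + - (r\<^sup>2 * t' / 2) + r * - (r * t')] = k"
        unfolding k3 k4 by (simp add: vec_eq_iff forall_4 r_def)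
      ultimately show ?thesis by simp
    qed
  qed
qed

section \<open>Reduction of an arbitrary scalar product to the two cases\<close>

lemma horizontal_combination: "a *\<^sub>R axis 1 1 + b *\<^sub>R axis 2 1 \<in> horizontal"
  unfolding horizontal_def by (intro span_add span_scale span_base) simp_all

lemma horizontal_eq:
  assumes "X \<in> horizontal"
  shows "X = X$1 *\<^sub>R axis 1 1 + X$2 *\<^sub>R axis 2 1"
proof -
  have "X$3 = 0 \<and> X$4 = 0"
    using assms unfolding horizontal_def
    by (induction rule: span_induct_alt) (auto simp: axis_def)
  then show ?thesis
    by (simp add: vec_eq_iff forall_4 axis_def)
qed

theorem theorem1p4:
  fixes B :: "engel \<Rightarrow> engel \<Rightarrow> real" and E :: "engel set"
  assumes "scalar_product_on horizontal B"
    and "E \<in> sets vol_engel"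
    and "\<exists>X. constant_horizontal_normal B E X"
  shows "\<exists>E'. lipschitz_euclidean_domain E' \<and> sym_diff E E' \<in> null_sets vol_engel"
proof -
  note E = assms(2)
  define e1 e2 :: engel where "e1 = axis 1 1" and "e2 = axis 2 1"
  obtain X where X: "X \<in> horizontal" "indicator_deriv_nonneg X E"
    and Y: "\<And>Y. Y \<in> horizontal \<Longrightarrow> B X Y = 0 \<Longrightarrow> indicator_deriv_zero Y E"
    using assms(3) by (auto simp: constant_horizontal_normal_def)
  have comb: "a *\<^sub>R e1 + b *\<^sub>R e2 \<in> horizontal" for a b
    unfolding e1_def e2_def by (rule horizontal_combination)
  have e: "e1 \<in> horizontal" "e2 \<in> horizontal"
    using comb[of 1 0] comb[of 0 1] by simp_all
  have scale: "c *\<^sub>R Z \<in> horizontal" if "Z \<in> horizontal" for c Z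
    using that by (simp add: horizontal_def span_scale)
  have B_sym: "B x y = B y x" if "x \<in> horizontal" "y \<in> horizontal" for x y
    using assms(1) that unfolding scalar_product_on_def by blast
  have B_add: "B (x + y) z = B x z + B y z"
    if "x \<in> horizontal" "y \<in> horizontal" "z \<in> horizontal" for x y z
    using assms(1) that unfolding scalar_product_on_def by blast
  have B_scale: "B (c *\<^sub>R x) y = c * B x y" if "x \<in> horizontal" "y \<in> horizontal" for c x y
    using assms(1) that unfolding scalar_product_on_def by blast
  have B_0: "B X Z = 0" if "X = 0" "Z \<in> horizontal" for Z
    using B_scale[OF X(1) that(2), of 0] that(1) by simp
  have BX: "B X (a *\<^sub>R e1 + b *\<^sub>R e2) = a * B X e1 + b * B X e2" for a b
  proof -
    have "B X (a *\<^sub>R e1 + b *\<^sub>R e2) = B (a *\<^sub>R e1 + b *\<^sub>R e2) X"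
      by (rule B_sym[OF X(1) comb])
    also have "\<dots> = B (a *\<^sub>R e1) X + B (b *\<^sub>R e2) X"
      by (rule B_add[OF scale scale X(1)]; rule e)
    also have "\<dots> = a * B X e1 + b * B X e2"
      by (simp only: B_scale[OF e(1) X(1)] B_scale[OF e(2) X(1)] B_sym[OF e(1) X(1)] B_sym[OF e(2) X(1)])
    finally show ?thesis .
  qed
  have X_eq: "X = X$1 *\<^sub>R e1 + X$2 *\<^sub>R e2"
    unfolding e1_def e2_def by (rule horizontal_eq[OF X(1)])
  have BXX: "B X X = X$1 * B X e1 + X$2 * B X e2"
    using BX[of "X$1" "X$2"] X_eq by simp
  have pos: "B X X > 0" if "X \<noteq> 0"
    using assms(1) X(1) that unfolding scalar_product_on_def by blast
  show ?thesis
  \<comment> \<open>The question is whether the field annihilating the indicator can be taken to be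
    \<open>e2\<close>, or has a nonzero \<open>e1\<close> component and can be scaled to
    \<open>e1 + \<beta> *\<^sub>R e2\<close>.\<close>
  proof (cases "B X e2 = 0")
    case True
    then have Z2: "indicator_deriv_zero e2 E" using Y e by blast
    have "\<exists>\<sigma>. \<bar>\<sigma>\<bar> = 1 \<and> indicator_deriv_nonneg (\<sigma> *\<^sub>R e1) E"
    \<comment> \<open>The zero vector may occur as normal. All of the horizontal layer is then
      orthogonal to it, so \<open>e1\<close> annihilates the indicator as well and \<open>1\<close>
      is a valid sign.\<close>
    proof (cases "X = 0")
      case True
      then have "indicator_deriv_zero e1 E" using Y[OF e(1) B_0] e(1) by blast
      then show ?thesis
        by (intro exI[of _ 1]) (simp add: indicator_deriv_nonneg_def indicator_deriv_zero_def)
    next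
      case False
      then have x1: "X$1 \<noteq> 0" using pos BXX True by auto
      \<comment> \<open>Subtracting the \<open>e2\<close> component, which contributes zero, and
        normalizing replaces \<open>X\<close> by \<open>e1\<close> or its negative.\<close>
      have "indicator_deriv_nonneg ((1 / \<bar>X$1\<bar>) *\<^sub>R X + (- X$2 / \<bar>X$1\<bar>) *\<^sub>R e2) E"
        by (rule indicator_deriv_nonneg_combination[OF E X(2) Z2]) simp
      also have "(1 / \<bar>X$1\<bar>) *\<^sub>R X + (- X$2 / \<bar>X$1\<bar>) *\<^sub>R e2 = (X$1 / \<bar>X$1\<bar>) *\<^sub>R e1"
        by (subst X_eq) (simp add: scaleR_add_right)
      finally show ?thesis
        using x1 by (intro exI[of _ "X$1 / \<bar>X$1\<bar>"]) simp
    qed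
    then show ?thesis
      using lipschitz_domain_vertical_case[OF E] Z2 unfolding e1_def e2_def by blast
  next
    case False
    define \<beta> where "\<beta> = - B X e1 / B X e2"
    have "B X (1 *\<^sub>R e1 + \<beta> *\<^sub>R e2) = 0"
      unfolding BX using False by (simp add: \<beta>_def)
    then have Z: "indicator_deriv_zero (e1 + \<beta> *\<^sub>R e2) E"
      using Y[OF comb[of 1 \<beta>]] by simp
    have "X \<noteq> 0" using B_0[OF _ e(2)] False by blast
    \<comment> \<open>\<open>d\<close> is the \<open>e2\<close> coefficient left after subtracting
      \<open>X$1\<close> times the annihilating field from \<open>X\<close>. It is nonzero because
      \<open>d * B X e2 = B X X > 0\<close>.\<close>
    define d where "d = X$2 - \<beta> * X$1"
    have "B X X = d * B X e2"
      unfolding BXX d_def \<beta>_def using False by (simp add: field_simps)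
    then have d: "d \<noteq> 0" using pos[OF \<open>X \<noteq> 0\<close>] by auto
    have "indicator_deriv_nonneg ((1 / \<bar>d\<bar>) *\<^sub>R X + (- X$1 / \<bar>d\<bar>) *\<^sub>R (e1 + \<beta> *\<^sub>R e2)) E"
      by (rule indicator_deriv_nonneg_combination[OF E X(2) Z]) simp
    also have "(1 / \<bar>d\<bar>) *\<^sub>R X + (- X$1 / \<bar>d\<bar>) *\<^sub>R (e1 + \<beta> *\<^sub>R e2) = (d / \<bar>d\<bar>) *\<^sub>R e2"
      by (subst X_eq) (simp add: vec_eq_iff d_def diff_divide_distrib algebra_simps)
    finally have "indicator_deriv_nonneg ((d / \<bar>d\<bar>) *\<^sub>R e2) E" .
    then show ?thesis
      using lipschitz_domain_transversal_case[OF E, of "d / \<bar>d\<bar>" \<beta>] Z d unfolding e1_def e2_def by simp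
  qed
qed

end
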